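(* Let $Q$ be a Buchsteiner loop and let $x,y,z\in Q$. Then $$[x,y,z][z,y,x]^{-1} = [y,z,x][x,z,y]^{-1} = [z,x,y][y,x,z]^{-1}.$$ Denote this element by $a$, and put $s_x = [x^2,y,z]$, $s_y = [y^2,z,x]$ and $s_z = [z^2,y,x]$. Then $a^2=1$, $a^x=a^y=a^z=a$, $[x,y,z]^2=[x,z,y]^2$, $[x^2,y,z]=[x^2,z,y]$, and $$[x,y,z][x,z,y]^{-1} = a s_x = [y,z,x][z,y,x]^{-1},$$ $$[y,z,x][y,x,z]^{-1} = a s_y = [z,x,y][x,z,y]^{-1},$$ $$[z,x,y][z,y,x]^{-1} = a s_z = [x,y,z][y,x,z]^{-1}.$$
   Context: A Buchsteiner loop is a loop $Q$ satisfying $x\backslash (xy\cdot z) = (y\cdot zx)/x$ for all $x,y,z$, where $\backslash$ and $/$ are left and right division. The nucleus $N=N(Q)$ is the set of all $a$ such that $a(xy)=(ax)y$, $x(ay)=(xa)y$ and $x(ya)=(xy)a$ for all $x,y\in Q$. The associator is $[x,y,z] = (x\cdot yz)\backslash(xy\cdot z)$. $A(Q)$ is the least normal subloop $A$ such that $Q/A$ is a group. In a Buchsteiner loop $N$ is a normal subloop, $Q/N$ is an abelian group of exponent dividing $4$, and all associators lie in the abelian group $A(Q)\le Z(N)$. For $n\in N$ and $v\in Q$, $n^v = v\backslash(nv)\in N$. *)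

theory Defs
  imports Main
begin

text \<open>
  Loops in the equational signature: multiplication, unit, and the two division operations
  \<open>ldiv x y\<close> (the solution \<open>u\<close> of \<open>x * u = y\<close>, written with a backslash in the literature) and
  \<open>rdiv y x\<close> (the solution \<open>u\<close> of \<open>u * x = y\<close>, written \<open>y / x\<close>).  The four division laws say
  exactly that all left and right translations are bijective.  The superclass \<open>power\<close> carries no
  axioms; it only provides \<open>x\<^sup>2 = x * (x * 1)\<close>, which equals \<open>x * x\<close> in a loop.
\<close>

class loop = power +
  fixes ldiv :: "'a \<Rightarrow> 'a \<Rightarrow> 'a"  (infixl "ldiv" 70)
    and rdiv :: "'a \<Rightarrow> 'a \<Rightarrow> 'a"  (infixl "rdiv" 70)
  assumes loop_one_left: "1 * x = x"
    and loop_one_right: "x * 1 = x"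
    and ldiv_mult: "x ldiv (x * y) = y"
    and mult_ldiv: "x * (x ldiv y) = y"
    and mult_rdiv: "(y * x) rdiv x = y"
    and rdiv_mult: "(y rdiv x) * x = y"

class buchsteiner_loop = loop +
  assumes buchsteiner: "x ldiv ((x * y) * z) = (y * (z * x)) rdiv x"

context loop
begin

definition associator :: "'a \<Rightarrow> 'a \<Rightarrow> 'a \<Rightarrow> 'a" where
  "associator x y z = (x * (y * z)) ldiv ((x * y) * z)"

text \<open>
  The right inverse.  Whenever \<open>x\<close> has a two-sided inverse, in particular for \<open>x\<close> in the nucleus
  (which contains all associators of a Buchsteiner loop), this is that inverse.
\<close>

definition loop_inv :: "'a \<Rightarrow> 'a" where
  "loop_inv x = x ldiv 1"

text \<open>\<open>conjugate n v\<close> is \<open>n\<close> conjugated by \<open>v\<close>, written \<open>n\<close> with exponent \<open>v\<close>.\<close>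

definition conjugate :: "'a \<Rightarrow> 'a \<Rightarrow> 'a" where
  "conjugate n v = v ldiv (n * v)"

end

end

theory Submission
  imports Defs
begin

text \<open>
  Let \<open>L\<^sub>x\<close> and \<open>R\<^sub>x\<close> be the translations of a Buchsteiner loop \<open>Q\<close>.  The defining identity says that
  \<open>(L\<^sub>x, inverse R\<^sub>x, L\<^sub>x \<circ> inverse R\<^sub>x)\<close> is an autotopism for every \<open>x\<close>; equivalently, the left inner map
  \<open>f\<^sub>x\<^sub>y\<close> with \<open>xy \<cdot> f\<^sub>x\<^sub>y(z) = x \<cdot> yz\<close> satisfies \<open>yz \<cdot> x = y \<cdot> f\<^sub>x\<^sub>y(z)x\<close> and \<open>z \<cdot> xy = f\<^sub>x\<^sub>y(z)x \<cdot> y\<close>.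

  Suppose first that all associators are nuclear.  Then they lie in the centre \<open>Z\<close> of the nucleus,
  which is an abelian group on which \<open>Q\<close> acts by conjugation; write it additively, with \<open>[x,y,z]\<close>
  for associators and \<open>v\<close> for the action of \<open>v\<close>.  The inner maps become automorphisms, so
  \<open>[x,y,uv] = v[x,y,u] + [x,y,v]\<close>, and the formulas above give the cyclic rule
  \<open>[y,z,x] = - x[x,y,z]\<close>.  It follows that commutators act trivially on associators, that squares do
  too, and that \<open>s(w,x,y,z) = (w - 1)[x,y,z]\<close> is symmetric in all four arguments and negated by each
  of them.  Applying the cyclic rule three times gives \<open>-2[x,y,z] = s(x,x,y,z) - s(y,x,y,z) + s(z,x,y,z)\<close>,
  and the doubles of the three terms on the right agree.  The theorem is then linear algebra over
  the integers (\<open>assoc_nuclear.associator_relations\<close>).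

  Let \<open>N\<close> be the nucleus.  That associators are nuclear is proved along \<open>Q\<close>, \<open>Q/N\<close> and the quotient of
  \<open>Q/N\<close> by its own nucleus.  Every
  \<open>f\<^sub>x\<^sub>y\<close> is both a left and a right pseudo-automorphism.  Comparing the two companions shows that
  they agree modulo \<open>N\<close> and commute with everything modulo \<open>N\<close>; so they are central in \<open>Q/N\<close> and
  disappear in the second quotient.  The second quotient therefore has the weak inverse property,
  which permutes the components of autotopisms cyclically and makes its quotient by the nucleus a
  group (\<open>wip.group_if_twist_trivial\<close>).

  It remains to descend: if associators of \<open>Q/N\<close> are nuclear, so are those of \<open>Q\<close>
  (\<open>quotient_nuclear.associator_nuc\<close>).  For \<open>m\<close> nuclear modulo \<open>N\<close> the associators \<open>[m,x,y]\<close> are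
  nuclear, and the calculus above applies to them.  An explicit autotopism whose second component sends
  \<open>b\<close> to \<open>v ldiv (vp \<cdot> b)\<close>, where \<open>p = [w,x,y]\<close> and \<open>v = w \<cdot> xy\<close>, yields \<open>[a,p,b] = [t,a,b]\<close> for all \<open>a\<close>, \<open>b\<close>, with \<open>t\<close> an
  explicit combination of associators modulo \<open>N\<close>.  The known relations between associators of
  \<open>Q/N\<close> then force both sides to vanish, so \<open>p\<close> is nuclear.
\<close>

section \<open>Loops and inner maps\<close>
declare loop_one_left [simp] loop_one_right [simp] ldiv_mult [simp] mult_ldiv [simp]
  mult_rdiv [simp] rdiv_mult [simp]

lemma mult_left_cancel [simp]: "x * y = x * z \<longleftrightarrow> y = z" for x y z :: "'a::loop"
  by (metis ldiv_mult)

lemma mult_right_cancel [simp]: "y * x = z * x \<longleftrightarrow> y = z" for x y z :: "'a::loop"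
  by (metis mult_rdiv)

lemma ldiv_eq_iff: "x ldiv y = z \<longleftrightarrow> y = x * z" for x y z :: "'a::loop"
  by auto

lemma rdiv_eq_iff: "y rdiv x = z \<longleftrightarrow> y = z * x" for x y z :: "'a::loop"
  by auto

lemma ldiv_one [simp]: "1 ldiv x = x" for x :: "'a::loop"
  by (simp add: ldiv_eq_iff)

lemma ldiv_self [simp]: "x ldiv x = 1" for x :: "'a::loop"
  by (simp add: ldiv_eq_iff)

lemma rdiv_self [simp]: "x rdiv x = 1" for x :: "'a::loop"
  by (simp add: rdiv_eq_iff)

lemma ldiv_left_cancel [simp]: "x ldiv y = x ldiv z \<longleftrightarrow> y = z" for x y z :: "'a::loop"
  by (metis mult_ldiv)

lemma rdiv_right_cancel [simp]: "y rdiv x = z rdiv x \<longleftrightarrow> y = z" for x y z :: "'a::loop"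
  by (metis rdiv_mult)

text \<open>
  The left inner map \<open>f\<^sub>x\<^sub>y\<close>: the composite of \<open>L\<^sub>x\<close> and \<open>L\<^sub>y\<close>, followed by the inverse of \<open>L\<^sub>x\<^sub>y\<close>.
\<close>

definition inner :: "'a::loop \<Rightarrow> 'a \<Rightarrow> 'a \<Rightarrow> 'a" where
  "inner x y z = (x * y) ldiv (x * (y * z))"

definition inner_inv :: "'a::loop \<Rightarrow> 'a \<Rightarrow> 'a \<Rightarrow> 'a" where
  "inner_inv x y z = y ldiv (x ldiv ((x * y) * z))"

lemma inner_inner_inv [simp]: "inner x y (inner_inv x y z) = z" and inner_inv_innerer [simp]: "inner_inv x y (inner x y z) = z"
  for x y z :: "'a::loop"
  by (simp_all add: inner_def inner_inv_def)

lemma inner_one [simp]: "inner x y 1 = 1" for x y :: "'a::loop"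
  by (simp add: inner_def)

lemma mult_inner: "(x * y) * inner x y z = x * (y * z)" for x y z :: "'a::loop"
  by (simp add: inner_def)

lemma buch_mult: "(x * y) * (z rdiv x) = x * ((y * z) rdiv x)"
  for x y z :: "'a::buchsteiner_loop"
  using buchsteiner[of x y "z rdiv x"] by (simp add: ldiv_eq_iff)

lemma buch_ldiv: "(x ldiv y) * (z * x) = (x ldiv (y * z)) * x"
  for x y z :: "'a::buchsteiner_loop"
  using buchsteiner[of x "x ldiv y" z] by (simp add: rdiv_eq_iff)

text \<open>
  In a Buchsteiner loop the left inner map is also the commutator of \<open>R\<^sub>x\<close> and \<open>L\<^sub>y\<close>, and
  (\<open>inner_right\<close>) an inner map for right translations.  All later arguments exploit that one
  permutation has these three descriptions.
\<close>

lemma inner_left: "(y * z) * x = y * (inner x y z * x)" for x y z :: "'a::buchsteiner_loop"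
  using buchsteiner[of x y "inner x y z"] by (simp add: mult_inner)

lemma inner_right: "v * (x * y) = (inner x y v * x) * y" for x y v :: "'a::buchsteiner_loop"
proof -
  have "y ldiv ((y * v) * x) = (v * (x * y)) rdiv y" by (rule buchsteiner)
  moreover have "y ldiv ((y * v) * x) = inner x y v * x" by (simp add: inner_left)
  ultimately show ?thesis by (metis rdiv_mult)
qed

section \<open>The nucleus\<close>

definition nuc :: "'a::loop set" where
  "nuc = {n. \<forall>y z. n * (y * z) = (n * y) * z}"

lemma nuc_left: "n \<in> nuc \<Longrightarrow> (n * y) * z = n * (y * z)" for n :: "'a::loop"
  by (simp add: nuc_def)

lemma nuc_iff_inner: "n \<in> nuc \<longleftrightarrow> (\<forall>y z. inner n y z = z)" for n :: "'a::loop"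
  unfolding nuc_def inner_def by (auto simp: ldiv_eq_iff)

text \<open>
  The three nuclei coincide because each of them is described by the same inner maps being trivial:
  a left nuclear \<open>n\<close> is one with \<open>inner n y = id\<close>, and the formulas \<open>inner_right\<close> and \<open>inner_left\<close>
  translate this into middle and right nuclearity.
\<close>

lemma nuc_mid_iff: "n \<in> nuc \<longleftrightarrow> (\<forall>v y. v * (n * y) = (v * n) * y)"
  for n :: "'a::buchsteiner_loop"
  unfolding nuc_iff_inner by (metis inner_right mult_right_cancel)

lemma nuc_right_iff: "n \<in> nuc \<longleftrightarrow> (\<forall>y z. (y * z) * n = y * (z * n))"
  for n :: "'a::buchsteiner_loop"
  unfolding nuc_iff_inner by (metis inner_left mult_right_cancel mult_left_cancel)

lemma nuc_mid: "n \<in> nuc \<Longrightarrow> (v * n) * y = v * (n * y)" for n :: "'a::buchsteiner_loop"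
  by (simp add: nuc_mid_iff)

lemma nuc_right: "n \<in> nuc \<Longrightarrow> (y * z) * n = y * (z * n)" for n :: "'a::buchsteiner_loop"
  by (simp add: nuc_right_iff)

lemma one_nuc [simp]: "1 \<in> nuc" by (simp add: nuc_def)

lemma mult_nuc [simp]: "m \<in> nuc \<Longrightarrow> n \<in> nuc \<Longrightarrow> m * n \<in> nuc" for m n :: "'a::loop"
  unfolding nuc_def by simp metis

lemma ldiv_nuc:
  fixes m n :: "'a::loop"
  assumes "m \<in> nuc" "m * n \<in> nuc" shows "n \<in> nuc"
proof -
  have "m * (n * (y * z)) = m * ((n * y) * z)" for y z
    using assms by (metis nuc_left)
  thus ?thesis by (simp add: nuc_def)
qed

lemma inv_nuc:
  fixes m :: "'a::loop"
  assumes "m \<in> nuc" shows "m ldiv 1 \<in> nuc" "(m ldiv 1) * m = 1"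
proof -
  show 1: "m ldiv 1 \<in> nuc" by (rule ldiv_nuc[OF assms]) simp
  have "m * ((m ldiv 1) * m) = m * 1" using nuc_left[OF assms, of "m ldiv 1" m] by simp
  thus "(m ldiv 1) * m = 1" by (simp only: mult_left_cancel)
qed

lemma inner_nuc_right: "n \<in> nuc \<Longrightarrow> inner x y (z * n) = inner x y z * n" for n :: "'a::buchsteiner_loop"
  by (simp add: inner_def ldiv_eq_iff flip: nuc_right)

lemma inner_nuc_left:
  fixes n :: "'a::buchsteiner_loop"
  assumes "n \<in> nuc" shows "inner x y (n * z) = n * inner x y z"
proof -
  have "((n * inner x y z) * x) * y = (n * z) * (x * y)"
    using assms by (simp add: nuc_left inner_right[of z])
  thus ?thesis by (metis inner_right mult_right_cancel)
qed

text \<open>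
  The autotopism belonging to left translation by \<open>n\<close> has identity as its second component.
  Conjugating it with the autotopism of \<open>x\<close> preserves that, and an autotopism with trivial second
  component is a left translation by a nuclear element.
\<close>

lemma conj_nuc:
  fixes n x :: "'a::buchsteiner_loop"
  assumes n: "n \<in> nuc" shows "x ldiv (n * x) \<in> nuc"
proof -
  let ?m = "x ldiv (n * x)"
  have *: "(x ldiv (n * (x * a))) * b = (x ldiv (n * (x * ((a * b) rdiv x)))) * x" for a b
  proof -
    have "(n * (x * a)) * (b rdiv x) = n * (x * ((a * b) rdiv x))"
      using n by (simp add: nuc_left buch_mult)
    thus ?thesis using buch_ldiv[of x "n * (x * a)" "b rdiv x"] by simp
  qed
  have "(x ldiv (n * (x * a))) * b = ?m * (a * b)" for a b
    using *[of a b] *[of 1 "a * b"] by simp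
  from this[of _ 1] this have "(?m * a) * b = ?m * (a * b)" for a b by simp
  thus ?thesis by (simp add: nuc_def)
qed

lemma conj_nuc':
  fixes n x :: "'a::buchsteiner_loop"
  assumes n: "n \<in> nuc" shows "(x * n) rdiv x \<in> nuc"
proof -
  let ?\<alpha> = "\<lambda>a. x * (n * (x ldiv a))"
  have *: "?\<alpha> a * b = ?\<alpha> (a * b)" for a b
  proof -
    have "(n * (x ldiv a)) * (b * x) = (n * (x ldiv (a * b))) * x"
      using n by (simp add: nuc_left buch_ldiv)
    thus ?thesis using buch_mult[of x "n * (x ldiv a)" "b * x"] by simp
  qed
  have **: "?\<alpha> 1 * b = ?\<alpha> b" for b using *[of 1 b] by simp
  have "?\<alpha> 1 * x = x * n" using **[of x] by simp
  moreover have "?\<alpha> 1 \<in> nuc" using * ** by (simp add: nuc_def)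
  ultimately show ?thesis by (metis mult_rdiv)
qed

section \<open>Companions of the inner maps\<close>

definition outer :: "'a::loop \<Rightarrow> 'a \<Rightarrow> 'a \<Rightarrow> 'a" where
  "outer x y a = x * (y * ((x * y) ldiv a))"

text \<open>
  Composing the autotopisms of \<open>x\<close>, of \<open>y\<close> and the inverse of that of \<open>xy\<close> produces the pair
  \<open>(outer x y, inner x y)\<close>.  As the second component fixes \<open>1\<close>, the third equals the first, which makes
  \<open>inner x y\<close> a left pseudo-automorphism with companion \<open>outer x y 1\<close>.  The other order of
  composition (\<open>inner_mult_right_companion\<close>) gives a right pseudo-automorphism.
\<close>

lemma outer_mult_inner: "outer x y a * inner x y b = outer x y (a * b)"
  for x y a b :: "'a::buchsteiner_loop"
proof -
  let ?u = "x * y"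
  have *: "outer x y a * inner x y b = x * ((y * (((?u ldiv (a * b)) * ?u) rdiv y)) rdiv x)" for a b
  proof -
    have "(y * (?u ldiv a)) * ((b * ?u) rdiv y) = y * (((?u ldiv (a * b)) * ?u) rdiv y)"
      by (simp add: buch_mult buch_ldiv)
    moreover have "inner x y b = ((b * ?u) rdiv y) rdiv x"
      by (simp add: inner_right)
    ultimately show ?thesis
      unfolding outer_def by (simp add: buch_mult)
  qed
  show ?thesis using *[of a b] *[of "a * b" 1] by simp
qed

definition left_companion :: "'a::loop \<Rightarrow> 'a \<Rightarrow> 'a" where
  "left_companion x y = outer x y 1"

definition right_companion :: "'a::loop \<Rightarrow> 'a \<Rightarrow> 'a" where
  "right_companion x y = inner x y (x * y) ldiv (x * y)"

lemma outer_eq: "outer x y a = left_companion x y * inner x y a" for x y a :: "'a::buchsteiner_loop"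
  unfolding left_companion_def by (simp add: outer_mult_inner)

lemma inner_mult_left_companion: "(left_companion x y * inner x y a) * inner x y b = left_companion x y * inner x y (a * b)"
  for x y a b :: "'a::buchsteiner_loop"
  by (metis outer_eq outer_mult_inner)

lemma inner_mult_right_companion: "inner x y a * (inner x y b * right_companion x y) = inner x y (a * b) * right_companion x y"
  for x y a b :: "'a::buchsteiner_loop"
proof -
  let ?u = "x * y" let ?\<beta> = "\<lambda>b. ((b rdiv y) rdiv x) * ?u"
  have *: "inner x y a * ?\<beta> b = (?u ldiv (x * ((y * ((a * b) rdiv y)) rdiv x))) * ?u" for a b
  proof -
    have "(x * (y * a)) * ((b rdiv y) rdiv x) = x * ((y * ((a * b) rdiv y)) rdiv x)"
      by (simp add: buch_mult)
    thus ?thesis unfolding inner_def by (simp add: buch_ldiv)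
  qed
  have 1: "inner x y a * ?\<beta> b = ?\<beta> (a * b)" for a b using *[of a b] *[of 1 "a * b"] by simp
  have 2: "?\<beta> a = inner x y a * ?\<beta> 1" for a using 1[of a 1] by simp
  have 3: "?\<beta> ?u = ?u" by simp
  have "right_companion x y = ?\<beta> 1" unfolding right_companion_def ldiv_eq_iff using 2[of ?u] 3 by simp
  thus ?thesis using 1 2 by metis
qed

text \<open>
  The first component determines an autotopism up to nuclear elements: the quotient of two such
  autotopisms has trivial first component, hence acts as a right translation by a nuclear element.
\<close>

lemma autotopism_same_left:
  fixes \<alpha> \<beta> \<beta>' \<gamma> \<gamma>' :: "'a::buchsteiner_loop \<Rightarrow> 'a"
  assumes 1: "\<And>a b. \<alpha> a * \<beta> b = \<gamma> (a * b)" and 2: "\<And>a b. \<alpha> a * \<beta>' b = \<gamma>' (a * b)"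
    and "bij \<beta>'"
  obtains n where "n \<in> nuc" "\<And>b. \<beta> b = \<beta>' (b * n)"
proof -
  define r where "r = (\<lambda>b. inv \<beta>' (\<beta> b))"
  have r: "\<beta> b = \<beta>' (r b)" for b
    using \<open>bij \<beta>'\<close> by (simp add: r_def bij_is_surj surj_f_inv_f)
  have \<gamma>: "\<gamma> b = \<gamma>' (r b)" for b using 1[of 1 b] 2[of 1 "r b"] by (simp add: r)
  have inj: "\<gamma>' a = \<gamma>' b \<Longrightarrow> a = b" for a b
    using 2[of 1 a] 2[of 1 b] \<open>bij \<beta>'\<close>
    by (metis bij_is_inj injD loop_one_left mult_left_cancel)
  have *: "a * r b = r (a * b)" for a b
    using 1[of a b] 2[of a "r b"] by (auto intro: inj simp: \<gamma> r)
  hence **: "r b = b * r 1" for b using *[of b 1] by simp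
  have "(y * z) * r 1 = y * (z * r 1)" for y z using *[of y z] ** by metis
  hence "r 1 \<in> nuc" by (simp add: nuc_right_iff)
  thus thesis using r ** that by metis
qed

lemma bij_rdiv [simp]: "bij (\<lambda>b. b rdiv x)" for x :: "'a::loop"
  by (rule bij_betw_byWitness[of _ "\<lambda>b. b * x"]) auto

text \<open>
  Dividing the left pseudo-automorphism equation by the right one gives an autotopism with first
  component \<open>L\<^sub>d\<close> and second component division by \<open>c\<close>; so does the Buchsteiner law, with \<open>d\<close> in place
  of \<open>c\<close>.
\<close>

lemma left_right_companion:
  fixes x y :: "'a::buchsteiner_loop"
  shows "\<exists>n\<in>nuc. left_companion x y = right_companion x y * n"
proof -
  let ?c = "right_companion x y" and ?d = "left_companion x y"
  have 1: "(?d * a) * (b rdiv ?c) = ?d * ((a * b) rdiv ?c)" for a b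
  proof -
    obtain a' b' where "a = inner x y a'" "b rdiv ?c = inner x y b'" by (metis inner_inner_inv)
    moreover have "b = inner x y b' * ?c" using calculation by (metis rdiv_mult)
    ultimately show ?thesis by (simp add: inner_mult_left_companion inner_mult_right_companion)
  qed
  have 2: "(?d * a) * (b rdiv ?d) = ?d * ((a * b) rdiv ?d)" for a b by (rule buch_mult)
  obtain n where "n \<in> nuc" "\<And>b. b rdiv ?c = (b * n) rdiv ?d"
    using autotopism_same_left[OF 1 2 bij_rdiv] by blast
  moreover have "1 = (?c * n) rdiv ?d" using calculation(2)[of ?c] by simp
  ultimately show ?thesis by (metis rdiv_mult loop_one_left)
qed

text \<open>
  Conjugating the autotopism of \<open>x\<close> by the left pseudo-automorphism, one obtains an autotopism
  that shares its first component with the composite of the autotopism of \<open>dg\<close> and the inverse of that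
  of \<open>d\<close>, where \<open>g\<close> is the image of \<open>x\<close>.  The second components involve \<open>gd\<close> and \<open>dg\<close>, respectively.
\<close>

lemma left_companion_commute:
  fixes x y g :: "'a::buchsteiner_loop"
  shows "\<exists>n\<in>nuc. left_companion x y * g = (g * left_companion x y) * n"
proof -
  let ?d = "left_companion x y" let ?h = "?d * g"
  have q1: "(?h * (?d ldiv s)) * ((t * ?d) rdiv (g * ?d)) = ?h * (?d ldiv ((s * t) rdiv g))" for s t
  proof -
    define x0 where "x0 = inner_inv x y g"
    have g: "g = inner x y x0" by (simp add: x0_def)
    have conj: "?d ldiv ((?d * r) rdiv g) = (r * ?d) rdiv (g * ?d)" for r
    proof -
      let ?e = "?d ldiv ((?d * r) rdiv g)"
      have "?d ldiv ((?d * ?e) * g) = (?e * (g * ?d)) rdiv ?d" by (rule buchsteiner)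
      hence "r = (?e * (g * ?d)) rdiv ?d" by simp
      hence "r * ?d = ?e * (g * ?d)" by (metis rdiv_mult)
      thus ?thesis by simp
    qed
    have div: "inner x y (b rdiv x0) = ?d ldiv ((?d * inner x y b) rdiv g)" for b
    proof -
      have "(?d * inner x y (b rdiv x0)) * g = ?d * inner x y b"
        unfolding g by (simp add: inner_mult_left_companion)
      thus ?thesis by (metis ldiv_mult mult_rdiv)
    qed
    define a where "a = inner_inv x y (?d ldiv s)"
    define b where "b = inner_inv x y t"
    have ab: "?d ldiv s = inner x y a" "t = inner x y b" by (simp_all add: a_def b_def)
    have "?d * inner x y (a * b) = s * t"
      by (metis ab inner_mult_left_companion mult_ldiv)
    hence ab': "inner x y (a * b) = ?d ldiv (s * t)" by (metis ldiv_mult)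
    have "(?d * inner x y (x0 * a)) * inner x y (b rdiv x0) = ?d * inner x y (x0 * ((a * b) rdiv x0))"
      by (simp add: inner_mult_left_companion buch_mult)
    hence "(?h * inner x y a) * inner x y (b rdiv x0) = ?h * inner x y ((a * b) rdiv x0)"
      unfolding g by (simp flip: inner_mult_left_companion)
    hence "(?h * (?d ldiv s)) * (?d ldiv ((?d * t) rdiv g)) = ?h * (?d ldiv ((?d * (?d ldiv (s * t))) rdiv g))"
      by (simp only: div ab(1)[symmetric] ab(2)[symmetric] ab')
    thus ?thesis by (simp add: conj)
  qed
  have q2: "(?h * (?d ldiv s)) * ((t * ?d) rdiv ?h) = ?h * (((?d ldiv (s * t)) * ?d) rdiv ?h)" for s t
    by (simp add: buch_mult buch_ldiv)
  have bij: "bij (\<lambda>t. (t * ?d) rdiv ?h)"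
    by (rule bij_betw_byWitness[of _ "\<lambda>t. (t * ?h) rdiv ?d"]) auto
  obtain n where n: "n \<in> nuc" and *: "\<And>t. (t * ?d) rdiv (g * ?d) = ((t * n) * ?d) rdiv ?h"
    using autotopism_same_left[OF q1 q2 bij] by blast
  have "?d * g = (g * n) * ?d" using *[of g] by (metis rdiv_self rdiv_mult loop_one_left)
  also have "\<dots> = g * (n * ?d)" using n by (rule nuc_mid)
  also have "\<dots> = (g * ?d) * (?d ldiv (n * ?d))" using conj_nuc[OF n] by (simp add: nuc_right)
  finally show ?thesis using conj_nuc[OF n] by blast
qed

section \<open>The quotient by the nucleus\<close>

definition nrel :: "'a::loop \<Rightarrow> 'a \<Rightarrow> bool" where
  "nrel x y \<longleftrightarrow> (\<exists>n\<in>nuc. y = x * n)"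

lemma nrel_refl [simp]: "nrel x x" for x :: "'a::loop"
  unfolding nrel_def by (rule bexI[of _ 1]) auto

lemma nrel_sym: "nrel x y \<Longrightarrow> nrel y x" for x y :: "'a::buchsteiner_loop"
  unfolding nrel_def
proof (elim bexE)
  fix n assume n: "n \<in> nuc" "y = x * n"
  hence "y * (n ldiv 1) = x" using inv_nuc(1)[OF n(1)] by (simp add: nuc_right)
  thus "\<exists>n\<in>nuc. x = y * n" using inv_nuc(1)[OF n(1)] by blast
qed

lemma nrel_trans: "nrel x y \<Longrightarrow> nrel y z \<Longrightarrow> nrel x z" for x y z :: "'a::buchsteiner_loop"
  unfolding nrel_def by (metis mult_nuc nuc_right)

lemma nrel_mult_right: "nrel (u * y) (v * y) \<longleftrightarrow> nrel u v" for u v y :: "'a::buchsteiner_loop"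
proof
  assume "nrel (u * y) (v * y)"
  then obtain n where n: "n \<in> nuc" "v * y = (u * y) * n" by (auto simp: nrel_def)
  let ?m = "(y * n) rdiv y"
  have m: "?m \<in> nuc" by (rule conj_nuc'[OF n(1)])
  have "v * y = u * (?m * y)" using n by (simp add: nuc_right)
  also have "\<dots> = (u * ?m) * y" using m by (simp add: nuc_mid)
  finally show "nrel u v" using m by (auto simp: nrel_def)
next
  assume "nrel u v"
  then obtain n where n: "n \<in> nuc" "v = u * n" by (auto simp: nrel_def)
  let ?m = "y ldiv (n * y)"
  have m: "?m \<in> nuc" by (rule conj_nuc[OF n(1)])
  have "v * y = u * (y * ?m)" using n by (simp add: nuc_mid)
  also have "\<dots> = (u * y) * ?m" using m by (simp add: nuc_right)
  finally show "nrel (u * y) (v * y)" using m by (auto simp: nrel_def)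
qed

lemma nrel_mult_left: "nrel (y * u) (y * v) \<longleftrightarrow> nrel u v" for u v y :: "'a::buchsteiner_loop"
  unfolding nrel_def by (metis mult_left_cancel nuc_right)

lemma nrel_mult: "nrel x x' \<Longrightarrow> nrel y y' \<Longrightarrow> nrel (x * y) (x' * y')"
  for x x' y y' :: "'a::buchsteiner_loop"
  by (metis nrel_mult_left nrel_mult_right nrel_trans)

lemma nrel_ldiv: "nrel x x' \<Longrightarrow> nrel y y' \<Longrightarrow> nrel (x ldiv y) (x' ldiv y')"
  for x x' y y' :: "'a::buchsteiner_loop"
  by (metis mult_ldiv nrel_mult_left nrel_mult_right nrel_sym nrel_trans)

lemma nrel_rdiv: "nrel x x' \<Longrightarrow> nrel y y' \<Longrightarrow> nrel (x rdiv y) (x' rdiv y')"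
  for x x' y y' :: "'a::buchsteiner_loop"
  by (metis rdiv_mult nrel_mult_left nrel_mult_right nrel_sym nrel_trans)

quotient_type (overloaded) 'a nquot = "'a::buchsteiner_loop" / nrel
  by (rule equivpI) (auto simp: reflp_def symp_def transp_def intro: nrel_sym nrel_trans)

instantiation nquot :: (buchsteiner_loop) buchsteiner_loop
begin

lift_definition one_nquot :: "'a nquot" is 1 .
lift_definition times_nquot :: "'a nquot \<Rightarrow> 'a nquot \<Rightarrow> 'a nquot" is "(*)" by (rule nrel_mult)
lift_definition ldiv_nquot :: "'a nquot \<Rightarrow> 'a nquot \<Rightarrow> 'a nquot" is "(ldiv)" by (rule nrel_ldiv)
lift_definition rdiv_nquot :: "'a nquot \<Rightarrow> 'a nquot \<Rightarrow> 'a nquot" is "(rdiv)" by (rule nrel_rdiv)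

instance
  by standard (transfer; simp add: buchsteiner)+

end

lift_definition qproj :: "'a::buchsteiner_loop \<Rightarrow> 'a nquot" is "\<lambda>x. x" .

lemma qproj_surj: "\<exists>x. X = qproj x" by transfer (rule exI, rule nrel_refl)

lemma qproj_eq_iff: "qproj x = qproj y \<longleftrightarrow> nrel x y"
  by transfer simp

lemma qproj_one [simp]: "qproj 1 = 1" by transfer simp
lemma qproj_mult: "qproj (x * y) = qproj x * qproj y" by transfer simp
lemma qproj_ldiv: "qproj (x ldiv y) = qproj x ldiv qproj y" by transfer simp
lemma qproj_rdiv: "qproj (x rdiv y) = qproj x rdiv qproj y" by transfer simp
lemma qproj_eq_1_iff: "qproj x = 1 \<longleftrightarrow> x \<in> nuc"
  using qproj_eq_iff[of 1 x] by (auto simp: nrel_def)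

lemma qproj_inner: "qproj (inner x y z) = inner (qproj x) (qproj y) (qproj z)"
  by (simp add: inner_def qproj_mult qproj_ldiv)

lemma qproj_nuc: "n \<in> nuc \<Longrightarrow> qproj n = 1" by (simp add: qproj_eq_1_iff)

text \<open>
  For commuting \<open>d\<close> the autotopism of \<open>d\<close> reads \<open>ad \<cdot> b = a \<cdot> db\<close>.
\<close>

lemma nuc_if_commuting:
  fixes d :: "'a::buchsteiner_loop"
  assumes "\<And>a. d * a = a * d"
  shows "d \<in> nuc"
proof -
  have "(a * d) * b = a * (d * b)" for a b
  proof -
    have "(d * a) * ((b * d) rdiv d) = d * ((a * (b * d)) rdiv d)" by (rule buch_mult)
    also have "\<dots> = a * (d * b)" by (simp add: assms)
    finally show ?thesis by (simp add: assms)
  qed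
  thus ?thesis by (simp add: nuc_mid_iff)
qed

lemma left_companion_nquot_commute: "left_companion X Y * g = g * left_companion X Y" for X Y g :: "'a::buchsteiner_loop nquot"
proof -
  obtain x y z where "X = qproj x" "Y = qproj y" "g = qproj z" using qproj_surj by metis
  moreover have "qproj (left_companion x y) = left_companion (qproj x) (qproj y)"
    by (simp add: left_companion_def outer_def qproj_mult qproj_ldiv)
  moreover have "qproj (left_companion x y * z) = qproj (z * left_companion x y)"
    unfolding qproj_eq_iff using left_companion_commute[of x y z] by - (rule nrel_sym, auto simp: nrel_def)
  ultimately show ?thesis by (metis qproj_mult)
qed

lemma companions_eq_nquot: "right_companion X Y = left_companion X Y" for X Y :: "'a::buchsteiner_loop nquot"
proof -
  obtain x y where "X = qproj x" "Y = qproj y" using qproj_surj by metis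
  moreover have "qproj (left_companion x y) = left_companion (qproj x) (qproj y)"
    by (simp add: left_companion_def outer_def qproj_mult qproj_ldiv)
  moreover have "qproj (right_companion x y) = right_companion (qproj x) (qproj y)"
    by (simp add: right_companion_def qproj_mult qproj_ldiv qproj_inner)
  moreover have "qproj (right_companion x y) = qproj (left_companion x y)"
    using left_right_companion[of x y] by (auto simp: qproj_eq_iff nrel_def)
  ultimately show ?thesis by simp
qed

lemma right_companion_nquot_nuc: "right_companion X Y \<in> nuc" for X Y :: "'a::buchsteiner_loop nquot"
  unfolding companions_eq_nquot by (rule nuc_if_commuting) (rule left_companion_nquot_commute)

text \<open>
  The companions are central in the first quotient, so they vanish in the second one.
\<close>

lemma inner_mult_self: "inner X Y (X * Y) = X * Y" for X Y :: "'a::buchsteiner_loop nquot nquot"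
proof -
  obtain x y where xy: "X = qproj x" "Y = qproj y" using qproj_surj by metis
  have "inner X Y (X * Y) ldiv (X * Y) = qproj (right_companion x y)"
    by (simp add: xy right_companion_def qproj_mult qproj_ldiv qproj_inner)
  also have "\<dots> = 1" by (rule qproj_nuc) (rule right_companion_nquot_nuc)
  finally show ?thesis by (simp add: ldiv_eq_iff)
qed

lemma inner_mult:
  fixes x y :: "'a::buchsteiner_loop"
  assumes "right_companion x y \<in> nuc"
  shows "inner x y (a * b) = inner x y a * inner x y b"
  using inner_mult_right_companion[of x y a b] nuc_right[OF assms, of "inner x y a" "inner x y b"] by simp

section \<open>The weak inverse property\<close>

abbreviation rho :: "'a::loop \<Rightarrow> 'a" where "rho x \<equiv> x ldiv 1"
abbreviation lam :: "'a::loop \<Rightarrow> 'a" where "lam x \<equiv> 1 rdiv x"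

lemma rho_lam [simp]: "rho (lam x) = x" and lam_rho [simp]: "lam (rho x) = x" for x :: "'a::loop"
  by (simp_all add: ldiv_eq_iff rdiv_eq_iff)

text \<open>
  Trivial companions make every inner map an automorphism.  As \<open>inner x y\<close> fixes \<open>x * y\<close>, it then fixes
  \<open>lam (x * y)\<close>, which is the weak inverse property \<open>lam_mult\<close>.
\<close>

locale wip =
  assumes inner_self: "\<And>x y :: 'a::buchsteiner_loop. inner x y (x * y) = x * y"
begin

lemma inner_hom: "inner x y (a * b) = inner x y a * inner x y b" for x y :: 'a
  by (rule inner_mult) (simp add: right_companion_def inner_self)

lemma lam_mult: "lam (x * y) * x = lam y" for x y :: 'a
proof -
  have "inner x y (lam (x * y)) * (x * y) = inner x y (lam (x * y) * (x * y))"
    by (metis inner_hom inner_self)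
  hence "inner x y (lam (x * y)) * (x * y) = lam (x * y) * (x * y)" by simp
  hence "inner x y (lam (x * y)) = lam (x * y)" by (simp only: mult_right_cancel)
  hence "(lam (x * y) * x) * y = 1" using inner_right[of "lam (x * y)" x y] by simp
  thus ?thesis by (simp add: eq_commute[of _ "lam y"] rdiv_eq_iff)
qed

lemma mult_rho: "x * rho (y * x) = rho y" for x y :: 'a
  using lam_mult[of x "rho (y * x)"]
  by (metis lam_rho rho_lam mult_rdiv)

lemma rho_mult: "rho (x * y) * rho (rho x) = rho y" for x y :: 'a
  by (metis lam_mult mult_rho rho_lam lam_rho)

lemma rho_rho_mult: "rho (rho (x * y)) = rho (rho x) * rho (rho y)" for x y :: 'a
  by (metis mult_rho rho_mult)

text \<open>
  In a loop with the weak inverse property the components of an autotopism may be permuted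
  cyclically, conjugating by \<open>rho\<close> where necessary.  This lemma and the next one are the two rotations of the
  autotopism of \<open>x\<close>.
\<close>

lemma wip_autotopism_right: "(u rdiv x) * ((x * v) rdiv rho (rho x)) = (u * v) rdiv rho (rho x)" for x u v :: 'a
proof -
  have r: "rho (x * lam v) = v rdiv rho (rho x)" for v
    using rho_mult[of x "lam v"] by (simp add: eq_commute[of _ "_ rdiv _"] rdiv_eq_iff)
  have *: "(b rdiv x) * rho (x * (lam w rdiv x)) = (b * w) rdiv rho (rho x)" for b w
  proof -
    have "lam (b * w) * b = lam w" by (rule lam_mult)
    hence "(x * lam (b * w)) * (b rdiv x) = x * (lam w rdiv x)" by (simp add: buch_mult)
    thus ?thesis using mult_rho[of "b rdiv x" "x * lam (b * w)"] by (simp add: r)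
  qed
  show ?thesis using *[of u v] *[of x v] by simp
qed

lemma wip_autotopism_left: "((x * u) rdiv rho (rho x)) * (rho (rho x) * v) = x * (u * v)" for x u v :: 'a
proof -
  have third: "rho (lam u rdiv x) = x * u" for u
    using mult_rho[of x "lam u rdiv x"] by simp
  have *: "((x * b) rdiv rho (rho x)) * rho (lam w rdiv rho (rho x)) = rho (lam (b * w) rdiv x)" for b w
  proof -
    have "(lam (b * w) rdiv x) * ((x * b) rdiv rho (rho x)) = lam w rdiv rho (rho x)"
      by (simp add: wip_autotopism_right lam_mult)
    thus ?thesis using mult_rho[of "(x * b) rdiv rho (rho x)" "lam (b * w) rdiv x"] by simp
  qed
  have "rho (lam w rdiv rho (rho x)) = rho (rho x) * w" for w
    using mult_rho[of "rho (rho x)" "lam w rdiv rho (rho x)"] by simp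
  thus ?thesis using *[of u v] third by simp
qed

text \<open>
  Composing the two rotations gives an autotopism whose first component is the quotient of the left
  translations by \<open>yx\<close> and \<open>y\<close>, where \<open>y = rho (rho x)\<close>.  The Buchsteiner autotopisms of \<open>yx\<close> and \<open>y\<close> give
  another one with the same first component.
\<close>

lemma twist_nuc:
  "\<exists>n\<in>nuc. \<forall>b. ((b * rho (rho (rho (rho x)))) rdiv rho (rho x)) * (rho (rho x) * x) = b * n" for x :: 'a
proof -
  let ?y = "rho (rho x)" let ?z = "rho (rho (rho (rho x)))"
  have 1: "(?y ldiv ((?y * x) * a)) * (b * ?z) = x * ((a * b) * ?z)" for a b
  proof -
    have "a * b = ((a * ?y) * (?y ldiv (b * ?z))) rdiv ?z"
      using wip_autotopism_right[of "a * ?y" ?y "?y ldiv (b * ?z)"] by simp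
    hence "(a * b) * ?z = (a * ?y) * (?y ldiv (b * ?z))" by simp
    thus ?thesis using wip_autotopism_left[of x "a * ?y" "?y ldiv (b * ?z)"] by (simp add: buchsteiner)
  qed
  have 2: "(?y ldiv ((?y * x) * a)) * ((b rdiv (?y * x)) * ?y) = (?y ldiv ((?y * x) * ((a * b) rdiv (?y * x)))) * ?y" for a b
    by (simp add: buch_ldiv buch_mult)
  have bij: "bij (\<lambda>b. (b rdiv (?y * x)) * ?y)"
    by (rule bij_betw_byWitness[of _ "\<lambda>b. (b rdiv ?y) * (?y * x)"]) auto
  obtain n where n: "n \<in> nuc" "\<And>b. b * ?z = ((b * n) rdiv (?y * x)) * ?y"
    using autotopism_same_left[OF 1 2 bij] by blast
  hence "((b * ?z) rdiv ?y) * (?y * x) = b * n" for b by simp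
  thus ?thesis using n(1) by blast
qed

text \<open>
  When the relation of \<open>twist_nuc\<close> holds exactly, evaluating it at \<open>1\<close> shows that \<open>rho\<close> has order
  dividing \<open>5\<close>.  Since \<open>rho \<circ> rho\<close> is multiplicative, so is \<open>rho\<close>; a short computation then gives
  \<open>rho (rho (rho x)) = x\<close> as well, whence \<open>rho\<close> is the identity and the loop is a group of exponent
  dividing \<open>2\<close>.
\<close>

lemma group_if_twist_trivial:
  assumes tw: "\<And>b x :: 'a. ((b * rho (rho (rho (rho x)))) rdiv rho (rho x)) * (rho (rho x) * x) = b"
  shows "(x * y) * z = x * (y * (z :: 'a))"
proof -
  have r4: "rho (rho (rho (rho x))) = lam x" for x :: 'a
  proof -
    let ?y = "rho (rho x)"
    have "rho (rho (rho (rho x))) rdiv ?y = lam (?y * x)"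
      using tw[of 1 x] by (simp add: eq_commute[of _ "lam _"] rdiv_eq_iff)
    hence "rho (rho (rho (rho x))) = lam (?y * x) * ?y" by (simp only: rdiv_eq_iff)
    thus ?thesis by (simp add: lam_mult)
  qed
  have r5: "rho (rho (rho (rho (rho x)))) = x" for x :: 'a by (simp add: r4)
  have "lam (x * y) = lam x * lam y" for x y :: 'a by (simp add: rho_rho_mult flip: r4)
  hence a1: "(x * y) * rho x = y" for x y :: 'a
    using lam_mult[of "rho x" "rho y"] by (metis lam_mult lam_rho rho_lam)
  hence a2: "x * (y * rho x) = y" for x y :: 'a
    by (metis mult_ldiv)
  have rh: "rho (x * y) = rho x * rho y" for x y :: 'a
    by (metis r5 rho_rho_mult)
  have v: "(rho x * (x * u)) * (rho (rho x) * w) = x * (u * w)" for x u w :: 'a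
    using wip_autotopism_left[of x u w] a1[of "rho x" "x * u"] by (metis mult_rdiv)
  hence v1: "(rho x * x) * (rho (rho x) * w) = x * w" for x w :: 'a
    using v[of x 1 w] by simp
  have r3: "rho (rho (rho x)) = x" for x :: 'a
  proof -
    let ?k = "rho x * x"
    have 1: "x * rho (rho (rho x)) = rho x * x" for x :: 'a
      using v1[of x "rho (rho (rho x))"] by simp
    have 2: "rho (rho x) * y = (x * y) * rho (rho x * x)" for x y :: 'a
      using v1[of x y] a1[of "rho x * x"] by metis
    have "x * x = x * rho (rho (rho (rho (rho x))))" by (simp add: r5)
    also have "\<dots> = ?k * (rho (rho x) * rho (rho (rho (rho (rho x)))))" by (simp only: v1)
    also have "\<dots> = ?k * rho (rho (rho x) * rho x)" by (simp only: 1 rh)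
    also have "\<dots> = rho (rho (rho x)) * x" by (simp only: 2)
    finally show ?thesis by (simp only: mult_right_cancel)
  qed
  have rx: "rho x = x" for x :: 'a by (metis r3 r5)
  have v': "(x * (x * u)) * (x * w) = x * (u * w)" for x u w :: 'a using v[of x u w] by (simp add: rx)
  have a1': "(x * y) * x = y" and a2': "x * (y * x) = y" for x y :: 'a
    using a1[of x y] a2[of x y] by (simp_all add: rx)
  have b': "(x * y) * (x * z) = x * (x * (y * z))" for x y z :: 'a
    using buch_mult[of x y "z"] a2' by (metis rdiv_eq_iff)
  have w': "(x * u) * (x * (x * v)) = x * (u * v)" for x u v :: 'a
    using wip_autotopism_right[of u x v] a2' by (simp add: rx) (metis rdiv_eq_iff)
  show ?thesis using v' a1' a2' b' w' by metis
qed

end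

section \<open>The centre of the nucleus as a module\<close>

lemma conj_nuc_mult: "n \<in> nuc \<Longrightarrow> v ldiv ((n * m) * v) = (v ldiv (n * v)) * (v ldiv (m * v))"
  if "m \<in> nuc" for n m v :: "'a::buchsteiner_loop"
  using that conj_nuc[of m v] conj_nuc[of n v]
  by (simp add: ldiv_eq_iff nuc_left flip: nuc_right)

text \<open>
  The centre of the nucleus, as a type of its own, so that calculations with associators take place
  in an additive group.
\<close>

typedef (overloaded) 'a znuc = "{n :: 'a::buchsteiner_loop. n \<in> nuc \<and> (\<forall>m\<in>nuc. n * m = m * n)}"
  by (rule exI[of _ 1]) simp

setup_lifting type_definition_znuc

lemma nuc_comm_inv:
  fixes n :: "'a::loop"
  assumes "n \<in> nuc" "\<forall>m\<in>nuc. n * m = m * n" "m \<in> nuc"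
  shows "(n ldiv 1) * m = m * (n ldiv 1)"
proof -
  let ?k = "n ldiv 1"
  have "n * (?k * m) = m" using nuc_left[OF assms(1), of ?k m] by simp
  moreover have "n * (m * ?k) = (m * n) * ?k"
    using nuc_left[OF assms(1), of m ?k, symmetric] assms(2)[rule_format, OF assms(3)] by (simp only:)
  moreover have "(m * n) * ?k = m" using nuc_left[OF assms(3), of n ?k] by simp
  ultimately have "n * (?k * m) = n * (m * ?k)" by simp
  thus ?thesis by (simp only: mult_left_cancel)
qed

instantiation znuc :: (buchsteiner_loop) ab_group_add
begin

lift_definition zero_znuc :: "'a znuc" is 1 by simp
lift_definition plus_znuc :: "'a znuc \<Rightarrow> 'a znuc \<Rightarrow> 'a znuc" is "(*)"
proof safe
  fix n k m :: 'a
  assume n: "n \<in> nuc" "\<forall>m\<in>nuc. n * m = m * n" and k: "k \<in> nuc" "\<forall>m\<in>nuc. k * m = m * k" and m: "m \<in> nuc"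
  show "n * k \<in> nuc" by (rule mult_nuc[OF n(1) k(1)])
  have "(n * k) * m = n * (k * m)" by (rule nuc_left[OF n(1)])
  also have "\<dots> = n * (m * k)" using k(2) m by (metis (no_types))
  also have "\<dots> = (n * m) * k" by (rule nuc_left[OF n(1), symmetric])
  also have "\<dots> = (m * n) * k" using n(2) m by (metis (no_types))
  also have "\<dots> = m * (n * k)" by (rule nuc_left[OF m])
  finally show "(n * k) * m = m * (n * k)" .
qed
lift_definition uminus_znuc :: "'a znuc \<Rightarrow> 'a znuc" is "\<lambda>n. n ldiv 1"
proof safe
  fix n m :: 'a
  assume n: "n \<in> nuc" "\<forall>m\<in>nuc. n * m = m * n" and m: "m \<in> nuc"
  show "n ldiv 1 \<in> nuc" by (rule inv_nuc(1)[OF n(1)])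
  show "(n ldiv 1) * m = m * (n ldiv 1)" by (rule nuc_comm_inv[OF n m])
qed
definition minus_znuc :: "'a znuc \<Rightarrow> 'a znuc \<Rightarrow> 'a znuc" where "minus_znuc a b = a + - b"

instance
proof
  fix a b c :: "'a znuc"
  show "a + b + c = a + (b + c)" by transfer (blast intro: nuc_left)
  show "a + b = b + a" by transfer blast
  show "0 + a = a" by transfer (rule loop_one_left)
  show "- a + a = 0" by transfer (blast intro: inv_nuc(2))
  show "a - b = a + - b" by (rule minus_znuc_def)
qed

end

lift_definition act :: "'a::buchsteiner_loop \<Rightarrow> 'a znuc \<Rightarrow> 'a znuc" is "\<lambda>v n. v ldiv (n * v)"
proof
  fix v n :: 'a assume n: "n \<in> nuc \<and> (\<forall>m\<in>nuc. n * m = m * n)"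
  from n have n1: "n \<in> nuc" by blast
  show "v ldiv (n * v) \<in> nuc" by (rule conj_nuc[OF n1])
  show "\<forall>m\<in>nuc. (v ldiv (n * v)) * m = m * (v ldiv (n * v))"
  proof
    fix m :: 'a assume m: "m \<in> nuc"
    define m' where "m' = (v * m) rdiv v"
    have m': "m' \<in> nuc" unfolding m'_def by (rule conj_nuc'[OF m])
    have "m = v ldiv (m' * v)" by (simp add: m'_def)
    moreover have "n * m' = m' * n" using n m' by blast
    ultimately show "(v ldiv (n * v)) * m = m * (v ldiv (n * v))"
      using conj_nuc_mult[OF m' n1, of v] conj_nuc_mult[OF n1 m', of v] by (simp only:)
  qed
qed

text \<open>
  Right multiplication by central nuclear elements.  With \<open>zmul_mult\<close> and \<open>mult_zmul\<close> such factors
  are collected at the right end of any product.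
\<close>

definition zmul :: "'a::buchsteiner_loop \<Rightarrow> 'a znuc \<Rightarrow> 'a" (infixl "\<odot>" 70) where
  "u \<odot> z = u * Rep_znuc z"

lemma Rep_znuc_nuc [simp]: "Rep_znuc z \<in> nuc" using Rep_znuc[of z] by blast

lemma zmul_mult: "(u \<odot> z) * v = (u * v) \<odot> act v z"
proof -
  have "u * (v * (v ldiv (Rep_znuc z * v))) = (u * v) * (v ldiv (Rep_znuc z * v))"
    by (rule nuc_right[symmetric]) (simp add: conj_nuc)
  thus ?thesis by (simp add: zmul_def act.rep_eq nuc_mid)
qed

lemma mult_zmul: "u * (v \<odot> z) = (u * v) \<odot> z"
  unfolding zmul_def by (simp add: nuc_right)

lemma zmul_zmul [simp]: "(u \<odot> z) \<odot> w = u \<odot> (z + w)"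
  unfolding zmul_def by (simp add: plus_znuc.rep_eq nuc_right)

lemma zmul_0 [simp]: "u \<odot> 0 = u" unfolding zmul_def by (simp add: zero_znuc.rep_eq)

lemma zmul_cancel [simp]: "u \<odot> z = u \<odot> w \<longleftrightarrow> z = w"
  unfolding zmul_def by (simp add: Rep_znuc_inject)

lemma act_mult: "act (u * v) z = act v (act u z)"
proof -
  have "(1 \<odot> z) * (u * v) = ((1 \<odot> z) * u) * v" unfolding zmul_def by (simp add: nuc_left)
  thus ?thesis by (simp add: zmul_mult)
qed

lemma act_add [simp]: "act v (z + w) = act v z + act v w"
  by (simp add: Rep_znuc_inject[symmetric] plus_znuc.rep_eq act.rep_eq conj_nuc_mult)

lemma act_0 [simp]: "act v 0 = 0" using act_add[of v 0 0] by simp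

lemma act_minus [simp]: "act v (- z) = - act v z"
  using act_add[of v z "- z"] by (simp add: eq_neg_iff_add_eq_0 add.commute)

lemma act_diff [simp]: "act v (z - w) = act v z - act v w"
  using act_add[of v z "- w"] by simp

lemma act_1 [simp]: "act 1 z = z"
  by (simp add: Rep_znuc_inject[symmetric] act.rep_eq)

lemma act_inj [simp]: "act v z = act v w \<longleftrightarrow> z = w"
  by (simp add: Rep_znuc_inject[symmetric] act.rep_eq)

lemma act_nuc: "n \<in> nuc \<Longrightarrow> act n z = z"
  using Rep_znuc[of z] unfolding Rep_znuc_inject[symmetric] act.rep_eq ldiv_eq_iff by blast

lemma act_rho: "act (rho v) (act v z) = z" and act_lam: "act v (act (lam v) z) = z"
  by (simp_all flip: act_mult)

lemma act_rho': "act v (act (rho v) z) = z"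
  by (metis act_inj act_rho)

definition nuclear_assoc :: "'a::buchsteiner_loop \<Rightarrow> 'a \<Rightarrow> 'a \<Rightarrow> bool" where
  "nuclear_assoc x y z \<longleftrightarrow> associator x y z \<in> nuc"

text \<open>
  The associator as an element of the centre of the nucleus; meaningful if the associator is
  nuclear.
\<close>

definition zassoc :: "'a::buchsteiner_loop \<Rightarrow> 'a \<Rightarrow> 'a \<Rightarrow> 'a znuc" where
  "zassoc x y z = Abs_znuc (associator x y z)"

lemma mult_associator: "(x * y) * z = (x * (y * z)) * associator x y z" for x y z :: "'a::loop"
  by (simp add: associator_def)

text \<open>
  An inner map commutes with both left and right multiplication by nuclear elements.  Comparing its
  values at \<open>kz = zm\<close> moves \<open>m\<close> past the associator.
\<close>

lemma associator_nuc_central: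
  fixes x y z :: "'a::buchsteiner_loop"
  assumes n: "associator x y z \<in> nuc" and m: "m \<in> nuc"
  shows "associator x y z * m = m * associator x y z"
proof -
  let ?n = "associator x y z"
  have "(x * y) * (inner x y z * ?n) = (x * y) * z"
    using nuc_right[OF n, of "x * y" "inner x y z"] by (simp only: mult_inner mult_associator[of x y z, symmetric])
  hence z: "z = inner x y z * ?n" by simp
  define k where "k = (z * m) rdiv z"
  have k: "k \<in> nuc" and kz: "k * z = z * m" unfolding k_def using conj_nuc'[OF m] by simp_all
  let ?f = "inner x y z"
  have "?f * (m * ?n) = (?f * m) * ?n" using n by (simp add: nuc_right)
  also have "\<dots> = inner x y (z * m) * ?n" using m by (simp add: inner_nuc_right)
  also have "\<dots> = (k * ?f) * ?n" using k by (simp add: inner_nuc_left flip: kz)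
  also have "\<dots> = k * (?f * ?n)" using k by (rule nuc_left)
  also have "\<dots> = (?f * ?n) * m" using kz by (simp only: z[symmetric])
  also have "\<dots> = ?f * (?n * m)" using m by (simp add: nuc_right)
  finally show ?thesis unfolding mult_left_cancel by (rule sym)
qed

lemma Rep_zassoc: "nuclear_assoc x y z \<Longrightarrow> Rep_znuc (zassoc x y z) = associator x y z"
  unfolding zassoc_def nuclear_assoc_def by (rule Abs_znuc_inverse) (blast intro: associator_nuc_central)

lemma mult_zassoc: "nuclear_assoc x y z \<Longrightarrow> (x * y) * z = (x * (y * z)) \<odot> zassoc x y z"
  by (simp only: mult_associator[of x y z] zmul_def Rep_zassoc)

lemma nuclear_assocI: assumes "(x * y) * z = (x * (y * z)) * n" "n \<in> nuc" shows "nuclear_assoc x y z"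
  unfolding nuclear_assoc_def associator_def assms(1) using assms(2) by simp

lemma zassoc_eqI: assumes "(x * y) * z = (x * (y * z)) \<odot> n" shows "nuclear_assoc x y z" "zassoc x y z = n"
proof -
  show *: "nuclear_assoc x y z" by (rule nuclear_assocI[of _ _ _ "Rep_znuc n"]) (simp_all add: assms flip: zmul_def)
  show "zassoc x y z = n" using mult_zassoc[OF *] assms by simp
qed

lemma inner_zassoc: assumes "nuclear_assoc x y z" shows "inner x y z = z \<odot> (- zassoc x y z)"
proof -
  have "(x * y) * (inner x y z \<odot> zassoc x y z) = (x * y) * z"
    by (simp add: mult_zmul mult_inner mult_zassoc[OF assms])
  hence *: "inner x y z \<odot> zassoc x y z = z" by simp
  have "inner x y z = (inner x y z \<odot> zassoc x y z) \<odot> (- zassoc x y z)" by simp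
  thus ?thesis by (simp only: *)
qed

text \<open>
  The cyclic rule is \<open>inner_left\<close>, with the inner map expressed by the associator.
\<close>

lemma zassoc_cycle: assumes "nuclear_assoc x y z" shows "nuclear_assoc y z x" "zassoc y z x = - act x (zassoc x y z)"
proof -
  have *: "(y * z) * x = (y * (z * x)) \<odot> (- act x (zassoc x y z))"
    using inner_left[of y z x] by (simp add: inner_zassoc[OF assms] zmul_mult mult_zmul)
  show "nuclear_assoc y z x" "zassoc y z x = - act x (zassoc x y z)" by (rule zassoc_eqI[OF *])+
qed

lemma zassoc_cycle2: assumes "nuclear_assoc x y z" shows "nuclear_assoc z x y" "zassoc z x y = act y (act x (zassoc x y z))"
  using zassoc_cycle[OF assms] zassoc_cycle[OF zassoc_cycle(1)[OF assms]] by simp_all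

lemma zassoc_cycle3: assumes "nuclear_assoc x y z" shows "act z (act y (act x (zassoc x y z))) = - zassoc x y z"
  using zassoc_cycle2[OF assms] zassoc_cycle[OF zassoc_cycle2(1)[OF assms]] by simp

text \<open>
  If all associators starting with \<open>x\<close>, \<open>y\<close> are nuclear, then so is the companion of \<open>inner x y\<close>, which is
  therefore an automorphism; its deviation from the identity is a crossed homomorphism.
\<close>

lemma zassoc_derivation:
  assumes "\<And>z. nuclear_assoc x y z"
  shows "zassoc x y (a * b) = act b (zassoc x y a) + zassoc x y b"
proof -
  have "right_companion x y = (1 \<odot> zassoc x y (x * y))"
    unfolding right_companion_def ldiv_eq_iff by (simp add: inner_zassoc[OF assms] mult_zmul)
  hence "right_companion x y \<in> nuc" by (simp add: zmul_def)
  hence "inner x y (a * b) = inner x y a * inner x y b" by (rule inner_mult)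
  hence "(a * b) \<odot> (- zassoc x y (a * b)) = (a * b) \<odot> (- act b (zassoc x y a) - zassoc x y b)"
    by (simp add: inner_zassoc[OF assms] zmul_mult mult_zmul)
  thus ?thesis by (simp add: algebra_simps)
qed

lemma act_assoc: "act (x * (y * z)) n = act ((x * y) * z) n"
  by (simp add: act_mult)

lemma act_associator [simp]: "act (associator x y z) n = n"
proof -
  obtain m where m: "n = act (x * (y * z)) m" by (metis act_lam)
  have "act (x * (y * z)) m = act ((x * y) * z) m" by (rule act_assoc)
  also have "\<dots> = act (associator x y z) (act (x * (y * z)) m)"
    by (simp only: act_mult[symmetric] mult_associator[of x y z, symmetric])
  finally show ?thesis by (simp add: m)
qed

section \<open>Crossed homomorphisms and quasi-nuclear elements\<close>

lemma act_inner: "act (inner x y v) n = act v n"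
proof -
  obtain k where n: "n = act (x * y) k" by (metis act_lam)
  have "act (inner x y v) n = act ((x * y) * inner x y v) k" by (simp only: act_mult n)
  also have "\<dots> = act (x * (y * v)) k" by (simp only: mult_inner)
  finally show ?thesis by (simp add: n act_mult)
qed

definition act_commuting :: "'a::buchsteiner_loop znuc \<Rightarrow> bool" where
  "act_commuting n \<longleftrightarrow> (\<forall>u v. act u (act v n) = act v (act u n))"

lemma act_commuting_act_swap: "act_commuting n \<Longrightarrow> act u (act v n) = act v (act u n)"
  by (simp add: act_commuting_def)

lemma act_commuting_diff [simp]: "act_commuting n \<Longrightarrow> act_commuting k \<Longrightarrow> act_commuting (n - k)"
  by (simp add: act_commuting_def)

lemma act_commuting_act [simp]: assumes "act_commuting n" shows "act_commuting (act c n)"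
  unfolding act_commuting_def
proof (intro allI)
  fix a b
  have "act a (act b (act c n)) = act a (act (c * b) n)" by (simp add: act_mult)
  also have "\<dots> = act (c * b) (act a n)" by (rule act_commuting_act_swap[OF assms])
  also have "\<dots> = act b (act a (act c n))" by (simp add: act_mult act_commuting_act_swap[OF assms, of a c])
  finally show "act a (act b (act c n)) = act b (act a (act c n))" .
qed

lemma act_commuting_pull:
  assumes "act_commuting n"
  shows "act a (act b (act c (act w n))) = act w (act a (act b (act c n)))"
proof -
  have "act c (act w n) = act w (act c n)" by (rule act_commuting_act_swap[OF assms])
  moreover have "act b (act w (act c n)) = act w (act b (act c n))"
    by (rule act_commuting_act_swap) (simp add: assms)
  moreover have "act a (act w (act b (act c n))) = act w (act a (act b (act c n)))"
    by (rule act_commuting_act_swap) (simp add: assms)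
  ultimately show ?thesis by simp
qed

locale derivation =
  fixes D :: "'a::buchsteiner_loop \<Rightarrow> 'a znuc"
  assumes D_mult: "D (u * v) = act v (D u) + D v"
begin

lemma D_one: "D 1 = 0" using D_mult[of 1 1] by simp

lemma D_inner: "D (inner x y v) = D v"
proof -
  have "D ((x * y) * inner x y v) = D ((x * y) * v)"
    by (simp only: mult_inner) (simp add: D_mult act_mult algebra_simps)
  thus ?thesis by (simp add: D_mult act_inner)
qed

lemma D_assoc: "D (x * (y * z)) = D ((x * y) * z)"
  by (simp add: D_mult act_mult algebra_simps)

end

text \<open>
  A crossed homomorphism that is constant on conjugacy classes vanishes on commutators.  Moreover
  commutators act trivially on its values, so \<open>Q\<close> acts on them through a commutative quotient.
\<close>

locale class_derivation = derivation +
  assumes D_conj: "D (v ldiv (y * v)) = D y"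
begin

lemma D_commute: "D (z * y) = D (y * z)"
proof -
  define w where "w = z ldiv ((z * y) * z)"
  have zw: "z * w = (z * y) * z" by (simp add: w_def)
  have act_w: "act w n = act (y * z) n" for n
  proof -
    obtain k where n: "n = act z k" by (metis act_lam)
    have "act w n = act (z * w) k" by (simp add: n act_mult)
    also have "\<dots> = act (y * z) n" by (simp add: zw n act_mult)
    finally show ?thesis .
  qed
  have "D (z * w) = D (z * (y * z))" by (simp only: zw D_assoc)
  hence "D w = D (y * z)" by (simp add: D_mult[of z] act_w)
  thus ?thesis unfolding w_def D_conj .
qed

lemma D_swap: "act z (D y) + D z = act y (D z) + D y"
  using D_commute[of z y] by (simp add: D_mult)

lemma act_conj_self: assumes "v * w = y * v" shows "act w (D v) = act y (D v)"
proof -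
  have "w = v ldiv (y * v)" by (simp flip: assms)
  hence Dw: "D w = D y" by (simp add: D_conj)
  have "act w (D v) + D w = D (y * v)" by (simp only: D_mult[symmetric] assms)
  also have "\<dots> = act y (D v) + D y" by (simp add: D_mult D_swap)
  finally show ?thesis by (simp add: Dw)
qed

text \<open>
  Here \<open>k\<close> is the commutator of \<open>y\<close> and \<open>v\<close>.  By \<open>act_conj_self\<close>, conjugation by \<open>v\<close> does not change the action of
  \<open>y\<close> on \<open>D v\<close>; exchanging the roles of \<open>v\<close> and \<open>y\<close> shows that \<open>k\<close> fixes \<open>D y\<close>.
\<close>

lemma D_commutator: assumes "v * (y * k) = y * (v :: 'a)" shows "D k = 0"
proof -
  obtain E where E: "D y = act y E" by (metis act_lam)
  obtain u where u: "y * u = lam v * y" by (metis mult_ldiv)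
  have "act u (D y) = act y (act (lam v) E)"
    unfolding E by (simp only: act_mult[symmetric] u)
  hence 1: "act y (act (lam v) E) = act (lam v) (D y)" using act_conj_self[OF u] by simp
  have "act k (D y) = act (y * k) (act v (act (lam v) E))" by (simp add: E act_mult act_lam)
  also have "\<dots> = act v (act y (act (lam v) E))"
  proof -
    have "act (y * k) (act v n) = act v (act y n)" for n by (simp only: act_mult[symmetric] assms)
    thus ?thesis .
  qed
  also have "\<dots> = D y" by (simp add: 1 act_lam)
  finally have 2: "act k (D y) = D y" .
  have "y * k = v ldiv (y * v)" by (simp flip: assms)
  hence "D (y * k) = D y" by (simp add: D_conj)
  thus ?thesis by (simp add: D_mult 2)
qed

lemma act_commutator: assumes "v * (y * k) = y * (v :: 'a)" shows "act k (D u) = D u"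
  using D_swap[of u k] D_commutator[OF assms] by simp

lemma act_commuting_D: "act_commuting (D u)"
  unfolding act_commuting_def
proof (intro allI)
  fix v y :: 'a
  define k where "k = y ldiv (v ldiv (y * v))"
  have k: "v * (y * k) = y * v" by (simp add: k_def)
  have D': "act c (D a) = D (a * c) - D c" for a c by (simp add: D_mult)
  have *: "act k (act c (D a)) = act c (D a)" for a c unfolding D' by (simp add: act_commutator[OF k])
  have "act v (act y (D u)) = act (v * (y * k)) (D u)" by (simp add: k act_mult)
  also have "\<dots> = act k (act y (act v (D u)))" by (simp add: act_mult)
  also have "\<dots> = act y (act v (D u))"
    using *[of "v * y" u] by (simp add: act_mult)
  finally show "act v (act y (D u)) = act y (act v (D u))" .
qed

end

text \<open>
  An element that becomes nuclear modulo the nucleus.  By the cyclic rule, all associators that contain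
  it are nuclear.
\<close>

locale quasi_nuclear =
  fixes m :: "'a::buchsteiner_loop"
  assumes nuclear_assoc1: "\<And>x y. nuclear_assoc m x y"
begin

lemma nuclear_assoc3: "nuclear_assoc x y m" by (rule zassoc_cycle(1)[OF nuclear_assoc1])
lemma nuclear_assoc2: "nuclear_assoc x m y" by (rule zassoc_cycle(1)[OF nuclear_assoc3])

abbreviation "T \<equiv> zassoc m"

sublocale T: derivation "T x" for x by standard (rule zassoc_derivation[OF nuclear_assoc1])

lemma zassoc_right: "zassoc x y m = - act m (T x y)" by (rule zassoc_cycle(2)[OF nuclear_assoc1])
lemma zassoc_mid: "zassoc y m x = act x (act m (T x y))" by (rule zassoc_cycle2(2)[OF nuclear_assoc1])
lemma T_cycle3: "act y (act x (act m (T x y))) = - T x y" by (rule zassoc_cycle3[OF nuclear_assoc1])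

sublocale zassoc_mid: derivation "zassoc x m" for x by standard (rule zassoc_derivation[OF nuclear_assoc2])

lemma T_mult_left': "act x (act m (T (x * y) z)) = act x (act m (T x z)) + act m (T y z)"
  using zassoc_mid.D_mult[of z x y] by (simp add: zassoc_mid act_mult) (simp flip: act_add)

text \<open>
  Expand \<open>v \<cdot> (mx \<cdot> y)\<close> in two ways, directly and by \<open>inner_right\<close> for the inner map of \<open>mx\<close>, \<open>y\<close>.  The
  associators \<open>[x,y,v]\<close>, which need not be nuclear, enter only through \<open>f = inner x y v\<close>, and both expansions contain the same product
  with \<open>f\<close>.
\<close>

lemma T_cocycle: "T x (y * v) + T y v = T (x * y) v + T x y"
proof -
  define f where "f = inner x y v"
  define \<nu> where "\<nu> = T x v - T (x * y) v"
  define \<kappa> where "\<kappa> = act m (T x (y * v) + T y v - T (x * y) v)"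
  have Tf: "T u f = T u v" for u by (simp add: f_def T.D_inner)
  have actf: "act f n = act v n" for n by (simp add: f_def act_inner)
  have f: "x * (y * v) = (x * y) * f" by (simp add: f_def mult_inner)
  have mul: "a * (b * c) = ((a * b) * c) \<odot> (- zassoc a b c)" if "nuclear_assoc a b c" for a b c
    using mult_zassoc[OF that] by simp
  have 1: "inner (m * x) y v = f \<odot> \<nu>"
  proof -
    have "((m * x) * y) * inner (m * x) y v = (m * x) * (y * v)" by (rule mult_inner)
    also have "\<dots> = (m * ((x * y) * f)) \<odot> T x (y * v)" by (simp only: mult_zassoc[OF nuclear_assoc1] f)
    also have "\<dots> = ((((m * x) * y) \<odot> - T x y) * f) \<odot> (T x (y * v) - T (x * y) v)"
      by (simp add: mul[OF nuclear_assoc1] Tf add.commute)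
    also have "\<dots> = ((m * x) * y) * (f \<odot> \<nu>)"
      by (simp add: zmul_mult mult_zmul \<nu>_def actf T.D_mult algebra_simps)
    finally show ?thesis by simp
  qed
  have 2: "inner x y (v * m) = (f * m) \<odot> \<kappa>"
  proof -
    have "(x * y) * inner x y (v * m) = x * (y * (v * m))" by (rule mult_inner)
    also have "\<dots> = (((x * y) * f) * m) \<odot> (- zassoc x (y * v) m - zassoc y v m)"
      by (simp add: mul[OF nuclear_assoc3] mult_zmul f add.commute)
    also have "\<dots> = (x * y) * ((f * m) \<odot> \<kappa>)"
      by (simp add: mult_zassoc[OF nuclear_assoc3] mult_zmul zassoc_right \<kappa>_def Tf algebra_simps)
    finally show ?thesis by simp
  qed
  have Af: "zassoc f m x = zassoc v m x" by (simp add: zassoc_mid Tf)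
  have "v * ((m * x) * y) = (inner (m * x) y v * (m * x)) * y" by (rule inner_right)
  hence 3: "v * ((m * x) * y) = ((f * (m * x)) * y) \<odot> act y (act x (act m \<nu>))"
    by (simp add: 1 zmul_mult act_mult)
  have "v * ((m * x) * y) = ((v * m) * (x * y)) \<odot> (T x y - zassoc v m (x * y))"
    by (simp add: mult_zassoc[OF nuclear_assoc1] mult_zmul mul[OF nuclear_assoc2])
  also have "(v * m) * (x * y) = (inner x y (v * m) * x) * y" by (rule inner_right)
  also have "\<dots> = ((f * (m * x)) * y) \<odot> (act y (zassoc v m x) + act y (act x \<kappa>))"
    by (simp add: 2 zmul_mult mult_zassoc[OF nuclear_assoc2] Af)
  finally have "act y (zassoc v m x) + act y (act x \<kappa>) + (T x y - zassoc v m (x * y)) = act y (act x (act m \<nu>))"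
    unfolding 3 by (simp add: add.assoc)
  moreover have "zassoc v m (x * y) = act y (zassoc v m x) + zassoc v m y" by (rule zassoc_mid.D_mult)
  moreover have "zassoc v m y = act y (act m (T y v))" by (rule zassoc_mid)
  ultimately have "act y (act x \<kappa>) + T x y - act y (act m (T y v)) = act y (act x (act m \<nu>))"
    by (simp add: algebra_simps)
  moreover have "act y (act m (T y v)) = act y (act x (act m (T (x * y) v))) - act y (act x (act m (T x v)))"
    using arg_cong[OF T_mult_left'[of x y v], of "act y"] by simp
  ultimately have "act y (act x (act m (T x (y * v) + T y v - T (x * y) v - T x y))) = 0"
    unfolding \<kappa>_def \<nu>_def by (simp add: algebra_simps T_cycle3)
  hence "act y (act x (act m (T x (y * v) + T y v - T (x * y) v - T x y))) = act y (act x (act m 0))"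
    by simp
  hence "T x (y * v) + T y v - T (x * y) v - T x y = 0" by (simp only: act_inj)
  thus ?thesis by (simp add: algebra_simps)
qed

lemma T_mult_left_conj: assumes "v * w = y * (v :: 'a)" shows "T (x * y) v = act w (T x v) + T y v"
proof -
  have *: "act v (act y n) = act w (act v n)" for n by (simp only: act_mult[symmetric] assms)
  have "act v (act y (act x (act m (T (x * y) v)))) = - T (x * y) v"
    using T_cycle3[of v "x * y"] by (simp add: act_mult)
  moreover have "act v (act y (act x (act m (T (x * y) v)))) = - act w (T x v) - T y v"
    unfolding T_mult_left' using T_cycle3[of v x] T_cycle3[of v y] by (simp add: *)
  ultimately have "- T (x * y) v = - act w (T x v) - T y v" by simp
  thus ?thesis by (simp add: algebra_simps)
qed

sublocale T: class_derivation "T x" for x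
proof
  fix v y :: 'a
  define w where "w = v ldiv (y * v)"
  have vw: "v * w = y * v" by (simp add: w_def)
  have "act w (T x v) + T x w = act v (T x y) + T x v"
    by (simp only: T.D_mult[symmetric] vw)
  moreover have "T x (y * v) + T y v = act w (T x v) + T y v + T x y"
    using T_cocycle[of x y v] T_mult_left_conj[OF vw] by simp
  ultimately have "T x w = T x y" by (simp add: T.D_mult algebra_simps)
  thus "T x (v ldiv (y * v)) = T x y" by (simp add: w_def)
qed

lemma act_commuting_T [simp]: "act_commuting (T x y)" by (rule T.act_commuting_D)

lemma T_mult_left: "T (x * y) v = act y (T x v) + T y v"
proof -
  define w where "w = v ldiv (y * v)"
  have vw: "v * w = y * v" by (simp add: w_def)
  show ?thesis using T_mult_left_conj[OF vw] T.act_conj_self[OF vw] by simp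
qed

text \<open>
  Polarise \<open>T_cycle3\<close>, substituting \<open>vw\<close> for \<open>v\<close>.  Substituting \<open>uw\<close> for \<open>u\<close> instead gives \<open>T_swap_left\<close>.
\<close>

lemma act_square [simp]: "act w (act w (T u v)) = T u v"
proof -
  have 1: "act w (act v (act u (act m (act w (T u v))))) = - act w (act w (T u v))"
    using act_commuting_pull[of "T u v" v u m w] by (simp add: T_cycle3)
  have 2: "act w (act v (act u (act m (T u w)))) = - act v (T u w)"
    using act_commuting_act_swap[of "act u (act m (T u w))" w v] by (simp add: T_cycle3)
  have "act (v * w) (act u (act m (T u (v * w)))) = - T u (v * w)" by (rule T_cycle3)
  hence "act w (act w (T u v)) + act v (T u w) = act w (T u v) + T u w"
    by (simp add: act_mult T.D_mult 1 2) (metis minus_add_distrib neg_equal_iff_equal diff_conv_add_uminus)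
  moreover have "T u v + act v (T u w) = act w (T u v) + T u w"
    using T.D_swap[of v u w] by (simp add: algebra_simps)
  ultimately show ?thesis by (metis add_right_cancel)
qed

lemma T_swap_right: "act w (T u v) - T u v = act v (T u w) - T u w"
  using T.D_swap[of w u v] by (simp add: algebra_simps)

lemma T_swap_left: "act w (T u v) - T u v = act u (T w v) - T w v"
proof -
  have 1: "act v (act w (act u (act m (act w (T u v))))) = - T u v"
  proof -
    have "act v (act w (act u (act m (act w (T u v))))) = act v (act w (act w (act u (act m (T u v)))))"
      using act_commuting_pull[of "T u v" 1 u m w] by simp
    also have "\<dots> = act w (act v (act w (act u (act m (T u v)))))"
      by (rule act_commuting_act_swap) simp
    also have "act v (act w (act u (act m (T u v)))) = act w (act v (act u (act m (T u v))))"
      by (rule act_commuting_act_swap) simp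
    finally show ?thesis by (simp add: T_cycle3)
  qed
  have 2: "act v (act w (act u (act m (T w v)))) = - act u (T w v)"
  proof -
    have "act w (act u (act m (T w v))) = act u (act w (act m (T w v)))"
      by (rule act_commuting_act_swap) simp
    moreover have "act v (act u (act w (act m (T w v)))) = act u (act v (act w (act m (T w v))))"
      by (rule act_commuting_act_swap) simp
    ultimately show ?thesis by (simp add: T_cycle3)
  qed
  have "act v (act (u * w) (act m (T (u * w) v))) = - T (u * w) v" by (rule T_cycle3)
  hence "- T u v - act u (T w v) = - act w (T u v) - T w v"
    by (simp add: act_mult T_mult_left 1 2)
  thus ?thesis by (simp add: algebra_simps)
qed

end

section \<open>Loops whose associators are nuclear\<close>

definition shift_assoc :: "'a::buchsteiner_loop \<Rightarrow> 'a \<Rightarrow> 'a \<Rightarrow> 'a \<Rightarrow> 'a znuc" where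
  "shift_assoc w x y z = act w (zassoc x y z) - zassoc x y z"

locale assoc_nuclear =
  fixes ty :: "'a::buchsteiner_loop itself"
  assumes nuclear_assoc: "\<And>x y z :: 'a. nuclear_assoc x y z"
begin

sublocale quasi_nuclear m for m :: 'a by standard (rule nuclear_assoc)

lemma zassoc_mult3: "zassoc x y (u * v) = act v (zassoc x y u) + zassoc x y v" for x y u v :: 'a
  by (rule T.D_mult)

lemma zassoc_cyc: "zassoc y z x = - act x (zassoc x y z)" for x y z :: 'a
  by (rule zassoc_cycle(2)[OF nuclear_assoc])

lemma zassoc_cyc2: "zassoc z x y = act y (act x (zassoc x y z))" for x y z :: 'a
  by (rule zassoc_cycle2(2)[OF nuclear_assoc])

lemma zassoc_mult1: "zassoc (u * v) y z = act v (zassoc u y z) + zassoc v y z" for y z u v :: 'a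
proof -
  have "act z (act y (act v (zassoc y z u))) = act v (act z (act y (zassoc y z u)))"
    using act_commuting_pull[of "zassoc y z u" 1 z y v] by simp
  thus ?thesis by (simp add: zassoc_cyc2[of _ y z] zassoc_mult3)
qed

lemma act_zassoc: "act w (zassoc x y z) = zassoc x y z + shift_assoc w x y z" for w x y z :: 'a
  by (simp add: shift_assoc_def)

lemma act_commuting_shift [simp]: "act_commuting (shift_assoc w x y z)" for w x y z :: 'a by (simp add: shift_assoc_def)

lemma shift_swap03: "shift_assoc w x y z = shift_assoc z x y w" for w x y z :: 'a
  unfolding shift_assoc_def by (rule T_swap_right)

lemma shift_swap02: "shift_assoc w x y z = shift_assoc y x w z" for w x y z :: 'a
  unfolding shift_assoc_def by (rule T_swap_left)

lemma shift_swap01: "shift_assoc w x y z = shift_assoc x w y z" for w x y z :: 'a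
proof -
  have *: "shift_assoc w x y z = act z (act y (shift_assoc w y z x))" for w x
    using act_commuting_pull[of "zassoc y z x" 1 z y w] by (simp add: shift_assoc_def zassoc_cyc2[of x y z])
  show ?thesis unfolding * by (simp add: shift_swap03[of w y z x])
qed

lemma shift_swap12: "shift_assoc w x y z = shift_assoc w y x z" for w x y z :: 'a
  by (metis shift_swap01 shift_swap02)

lemma shift_swap23: "shift_assoc w x y z = shift_assoc w x z y" for w x y z :: 'a
  by (metis shift_swap02 shift_swap03)

text \<open>
  A cyclic permutation of the last three arguments of \<open>shift_assoc\<close> multiplies it by \<open>- act x\<close>, but
  \<open>shift_assoc\<close> is symmetric.
\<close>

lemma shift_neg1: "act x (shift_assoc w x y z) = - shift_assoc w x y z" for w x y z :: 'a
proof -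
  have "shift_assoc w y z x = - act x (shift_assoc w x y z)"
    using act_commuting_act_swap[of "zassoc x y z" w x] by (simp add: shift_assoc_def zassoc_cyc[of y z x] algebra_simps)
  moreover have "shift_assoc w y z x = shift_assoc w x y z" by (metis shift_swap12 shift_swap23)
  ultimately show ?thesis by (metis minus_minus)
qed

lemma shift_neg2: "act y (shift_assoc w x y z) = - shift_assoc w x y z" for w x y z :: 'a
  using shift_neg1[of y w x z] by (simp add: shift_swap12[of w y])

lemma shift_neg3: "act z (shift_assoc w x y z) = - shift_assoc w x y z" for w x y z :: 'a
  using shift_neg2[of z w x y] by (simp add: shift_swap23[of w x z])

text \<open>
  Expand \<open>shift_assoc w x y (z * x)\<close>, which is negated by \<open>z * x\<close>.
\<close>

lemma shift_double: "shift_assoc w x y z + shift_assoc w x y z = shift_assoc w x y x - act z (shift_assoc w x y x)" for w x y z :: 'a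
proof -
  let ?s = "shift_assoc w x y z" and ?s' = "shift_assoc w x y x"
  have "shift_assoc w x y (z * x) = act x ?s + ?s'"
    using act_commuting_act_swap[of "zassoc x y z" w x] by (simp add: shift_assoc_def zassoc_mult3 algebra_simps)
  hence e: "shift_assoc w x y (z * x) = ?s' - ?s" by (simp add: shift_neg1)
  have "act x (act z ?s') = act z (act x ?s')" by (rule act_commuting_act_swap) simp
  hence "act (z * x) (?s' - ?s) = - act z ?s' - ?s"
    by (simp add: act_mult shift_neg1 shift_neg3)
  moreover have "act (z * x) (?s' - ?s) = - (?s' - ?s)" using shift_neg3[of "z * x" w x y] by (simp only: e)
  ultimately have "- act z ?s' - ?s = ?s - ?s'" by simp
  thus ?thesis by (simp add: algebra_simps)
qed

lemma shift_double_eq: "shift_assoc z x y z + shift_assoc z x y z = shift_assoc x x y z + shift_assoc x x y z" for w x y z :: 'a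
  unfolding shift_double[of z x y z] by (simp add: shift_neg3 shift_swap03[of z x y x])

lemma zassoc_double: "- (zassoc x y z + zassoc x y z) = shift_assoc x x y z - shift_assoc y x y z + shift_assoc z x y z" for w x y z :: 'a
proof -
  have "act z (act y (act x (zassoc x y z))) = - zassoc x y z" by (rule zassoc_cycle3[OF nuclear_assoc])
  hence "zassoc x y z + shift_assoc z x y z - shift_assoc y x y z + shift_assoc x x y z = - zassoc x y z"
    by (simp add: act_zassoc shift_neg1 shift_neg2 shift_neg3 algebra_simps)
  thus ?thesis by (simp add: algebra_simps)
qed

text \<open>
  All associators of \<open>x\<close>, \<open>y\<close>, \<open>z\<close> are integral combinations of \<open>P = [x,y,z]\<close>, of \<open>a\<close>, and of the differences \<open>t\<close>
  and \<open>u\<close> of the three terms \<open>shift_assoc\<close>.  As \<open>a\<close>, \<open>t\<close>, \<open>u\<close> have order dividing \<open>2\<close>, the relations are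
  checked by normalising.
\<close>

lemma associator_relations:
  fixes x y z :: 'a
  defines "a \<equiv> zassoc x y z - zassoc z y x"
  shows "a = zassoc y z x - zassoc x z y" and "a = zassoc z x y - zassoc y x z"
    and "a + a = 0" and "act x a = a" and "act y a = a" and "act z a = a"
    and "zassoc x y z + zassoc x y z = zassoc x z y + zassoc x z y"
    and "zassoc (x * x) y z = zassoc (x * x) z y"
    and "zassoc x y z - zassoc x z y = a + zassoc (x * x) y z"
    and "zassoc y z x - zassoc z y x = a + zassoc (x * x) y z"
    and "zassoc y z x - zassoc y x z = a + zassoc (y * y) z x"
    and "zassoc z x y - zassoc x z y = a + zassoc (y * y) z x"
    and "zassoc z x y - zassoc z y x = a + zassoc (z * z) y x"
    and "zassoc x y z - zassoc y x z = a + zassoc (z * z) y x"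
proof -
  define P where "P = zassoc x y z"
  define t where "t = shift_assoc z x y z - shift_assoc x x y z"
  define u where "u = shift_assoc y x y z - shift_assoc x x y z"
  have Q: "zassoc z y x = P - a" by (simp add: a_def P_def)
  have "shift_assoc z x y z + shift_assoc z x y z = shift_assoc x x y z + shift_assoc x x y z" by (rule shift_double_eq)
  hence tt: "t + t = 0" by (simp add: t_def algebra_simps)
  have "shift_assoc y x y z + shift_assoc y x y z = shift_assoc x x y z + shift_assoc x x y z"
    using shift_double_eq[of z y x] shift_double_eq[of z x y]
    by (simp add: shift_swap12[of z y x] shift_swap12[of y y x])
  hence uu: "u + u = 0" by (simp add: u_def algebra_simps)
  have 1: "- (P + P) = shift_assoc x x y z - shift_assoc y x y z + shift_assoc z x y z" unfolding P_def by (rule zassoc_double)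
  have "shift_assoc y z y x = shift_assoc y x y z" by (metis shift_swap12 shift_swap23)
  moreover have "shift_assoc z z y x = shift_assoc z x y z" by (metis shift_swap12 shift_swap23)
  moreover have Sx: "shift_assoc w z y x = shift_assoc w x y z" for w by (metis shift_swap12 shift_swap23)
  ultimately have "- (zassoc z y x + zassoc z y x) = shift_assoc z x y z - shift_assoc y x y z + shift_assoc x x y z"
    using zassoc_double[of z y x] by simp
  hence aa: "a + a = 0" using 1 by (simp add: Q algebra_simps)
  have aa': "a + (a + v) = v" and tt': "t + (t + v) = v" and uu': "u + (u + v) = v" for v
    by (simp_all add: aa tt uu flip: add.assoc)
  have neg: "- a = a" "- t = t" "- u = u"
    using aa tt uu by (simp_all add: minus_unique)
  have s1: "shift_assoc x x y z = u - t - (P + P)"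
  proof -
    have "- (P + P) = shift_assoc x x y z - (u + shift_assoc x x y z) + (t + shift_assoc x x y z)"
      unfolding 1 by (simp add: t_def u_def)
    hence "shift_assoc x x y z = - (P + P) + u - t" by (simp add: algebra_simps)
    thus ?thesis by (simp add: algebra_simps)
  qed
  have s2: "shift_assoc y x y z = u + shift_assoc x x y z" and s3: "shift_assoc z x y z = t + shift_assoc x x y z"
    by (simp_all add: t_def u_def)
  have actP: "act w P = P + shift_assoc w x y z" for w unfolding P_def by (rule act_zassoc)
  have actQ: "act w (P - a) = P - a + shift_assoc w x y z" for w
    unfolding Q[symmetric] Sx[symmetric] by (rule act_zassoc)
  have A1: "zassoc y z x = - P - shift_assoc x x y z"
    by (simp add: zassoc_cyc[of y z x] act_zassoc P_def)
  have A2: "zassoc z x y = P + shift_assoc y x y z - shift_assoc x x y z"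
    by (simp add: zassoc_cyc2[of z x y] act_zassoc P_def shift_neg2 algebra_simps)
  have A3: "zassoc y x z = - (P - a) - shift_assoc z x y z"
    by (simp only: zassoc_cyc[of y x z] Q actQ) (simp add: algebra_simps)
  have A4: "zassoc x z y = P - a + shift_assoc y x y z - shift_assoc z x y z"
    by (simp only: zassoc_cyc2[of x z y] Q actQ act_add shift_neg2) (simp add: algebra_simps)
  have B1: "zassoc (x * x) y z = P + P + shift_assoc x x y z" by (simp add: zassoc_mult1 act_zassoc P_def algebra_simps)
  have B2: "zassoc (x * x) z y = zassoc x z y + zassoc x z y + shift_assoc x x y z"
    by (simp add: zassoc_mult1 act_zassoc shift_swap23[of x x z y] algebra_simps)
  have B3: "zassoc (y * y) z x = zassoc y z x + zassoc y z x + shift_assoc y x y z"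
  proof -
    have "shift_assoc y y z x = shift_assoc y x y z" by (metis shift_swap12 shift_swap23)
    thus ?thesis by (simp add: zassoc_mult1 act_zassoc algebra_simps)
  qed
  have B4: "zassoc (z * z) y x = zassoc z y x + zassoc z y x + shift_assoc z x y z"
    by (simp add: zassoc_mult1 act_zassoc Sx algebra_simps)
  note eqs = Q P_def[symmetric] A1 A2 A3 A4 B1 B2 B3 B4 s2 s3 s1 diff_conv_add_uminus neg
    add_ac aa tt uu aa' tt' uu'
  show "a = zassoc y z x - zassoc x z y" by (simp add: eqs del: add_uminus_conv_diff uminus_add_conv_diff)
  show "a = zassoc z x y - zassoc y x z" by (simp add: eqs del: add_uminus_conv_diff uminus_add_conv_diff)
  show "a + a = 0" by (rule aa)
  have "act w a = a" for w
  proof -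
    have "act w a = act w P - act w (P - a)" by simp
    also have "\<dots> = a" unfolding actP actQ by simp
    finally show ?thesis .
  qed
  thus "act x a = a" "act y a = a" "act z a = a" by blast+
  show "zassoc x y z + zassoc x y z = zassoc x z y + zassoc x z y" by (simp add: eqs del: add_uminus_conv_diff uminus_add_conv_diff)
  show "zassoc (x * x) y z = zassoc (x * x) z y" by (simp add: eqs del: add_uminus_conv_diff uminus_add_conv_diff)
  show "zassoc x y z - zassoc x z y = a + zassoc (x * x) y z" by (simp add: eqs del: add_uminus_conv_diff uminus_add_conv_diff)
  show "zassoc y z x - zassoc z y x = a + zassoc (x * x) y z" by (simp add: eqs del: add_uminus_conv_diff uminus_add_conv_diff)
  show "zassoc y z x - zassoc y x z = a + zassoc (y * y) z x" by (simp add: eqs del: add_uminus_conv_diff uminus_add_conv_diff)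
  show "zassoc z x y - zassoc x z y = a + zassoc (y * y) z x" by (simp add: eqs del: add_uminus_conv_diff uminus_add_conv_diff)
  show "zassoc z x y - zassoc z y x = a + zassoc (z * z) y x" by (simp add: eqs del: add_uminus_conv_diff uminus_add_conv_diff)
  show "zassoc x y z - zassoc y x z = a + zassoc (z * z) y x" by (simp add: eqs del: add_uminus_conv_diff uminus_add_conv_diff)
qed

lemma associator_identities:
  fixes x y z :: 'a
  shows "associator x y z * loop_inv (associator z y x)
           = associator y z x * loop_inv (associator x z y)
       \<and> associator y z x * loop_inv (associator x z y)
           = associator z x y * loop_inv (associator y x z)
       \<and> (let a = associator x y z * loop_inv (associator z y x);
              s\<^sub>x = associator (x\<^sup>2) y z;
              s\<^sub>y = associator (y\<^sup>2) z x;
              s\<^sub>z = associator (z\<^sup>2) y x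
          in a\<^sup>2 = 1
           \<and> conjugate a x = a \<and> conjugate a y = a \<and> conjugate a z = a
           \<and> (associator x y z)\<^sup>2 = (associator x z y)\<^sup>2
           \<and> associator (x\<^sup>2) y z = associator (x\<^sup>2) z y
           \<and> associator x y z * loop_inv (associator x z y) = a * s\<^sub>x
           \<and> a * s\<^sub>x = associator y z x * loop_inv (associator z y x)
           \<and> associator y z x * loop_inv (associator y x z) = a * s\<^sub>y
           \<and> a * s\<^sub>y = associator z x y * loop_inv (associator x z y)
           \<and> associator z x y * loop_inv (associator z y x) = a * s\<^sub>z
           \<and> a * s\<^sub>z = associator x y z * loop_inv (associator y x z))"
proof -
  have sq: "v\<^sup>2 = v * v" for v :: 'a by (simp add: numeral_2_eq_2)
  have assoc: "associator u v w = Rep_znuc (zassoc u v w)" for u v w :: 'a by (simp add: Rep_zassoc nuclear_assoc)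
  have mult: "Rep_znuc n * Rep_znuc k = Rep_znuc (n + k)" for n k :: "'a znuc"
    by (simp add: plus_znuc.rep_eq)
  have inv: "Rep_znuc n * loop_inv (Rep_znuc k) = Rep_znuc (n - k)" for n k :: "'a znuc"
    using plus_znuc.rep_eq[of n "- k"] by (simp add: loop_inv_def uminus_znuc.rep_eq)
  have conj: "conjugate (Rep_znuc n) v = Rep_znuc (act v n)" for n and v :: 'a
    by (simp add: conjugate_def act.rep_eq)
  have one: "(1 :: 'a) = Rep_znuc 0" by (simp add: zero_znuc.rep_eq)
  note rel = associator_relations[where x = x and y = y and z = z]
  show ?thesis
    unfolding Let_def sq assoc inv mult conj one Rep_znuc_inject
    by (intro conjI; use rel in metis)
qed

end

section \<open>An autotopism that shifts associators\<close>

lemma zassoc_nuc_left: "n \<in> nuc \<Longrightarrow> zassoc n x y = 0"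
  by (rule zassoc_eqI(2)) (simp add: nuc_left)

lemma nuclear_assoc_nuc_left: "n \<in> nuc \<Longrightarrow> nuclear_assoc n x y"
  by (rule zassoc_eqI(1)[of _ _ _ 0]) (simp add: nuc_left)

lemma nuc_if_zassoc_mid:
  assumes "\<And>a b. nuclear_assoc a p b" "\<And>a b. zassoc a p b = 0"
  shows "p \<in> nuc"
  unfolding nuc_mid_iff using mult_zassoc[OF assms(1)] by (simp add: assms(2))

context quasi_nuclear
begin

lemma T_associator_left: "T (associator x y z) v = 0"
proof -
  have "T ((x * y) * z) v = T (x * (y * z)) v"
    by (simp add: T_mult_left act_mult algebra_simps)
  thus ?thesis by (simp add: mult_associator[of x y z] T_mult_left)
qed

lemma zassoc_mid_mult_left: "zassoc (u * v) m y = act v (zassoc u m y) + zassoc v m y"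
proof -
  have "act y (act m (act v (T y u))) = act v (act y (act m (T y u)))"
    using act_commuting_pull[of "T y u" 1 y m v] by simp
  thus ?thesis by (simp add: zassoc_mid T.D_mult)
qed

lemma zassoc_mid_zmul_left: "zassoc (u \<odot> n) m y = zassoc u m y"
  by (simp add: zmul_def zassoc_mid_mult_left act_nuc zassoc_nuc_left)

end

text \<open>
  The pentagon identity for \<open>m\<close>, \<open>k\<close>, \<open>u\<close>, \<open>v\<close>.
\<close>

lemma zassoc_mult_quasi:
  assumes m: "quasi_nuclear m" and k: "quasi_nuclear k" and 0: "\<And>v. zassoc m k v = 0"
  shows "nuclear_assoc (m * k) u v" "zassoc (m * k) u v = zassoc m u v + zassoc k u v"
proof -
  interpret m: quasi_nuclear m by (rule m)
  interpret k: quasi_nuclear k by (rule k)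
  have mk: "(m * k) * u = m * (k * u)" for u using mult_zassoc[OF m.nuclear_assoc1, of k u] by (simp add: 0)
  have "((m * k) * u) * v = ((m * k) * (u * v)) \<odot> (zassoc m u v + zassoc k u v)"
    by (simp add: mk mult_zassoc[OF m.nuclear_assoc1] mult_zassoc[OF k.nuclear_assoc1] mult_zmul m.T_mult_left 0 add.commute)
  from zassoc_eqI[OF this] show "nuclear_assoc (m * k) u v" "zassoc (m * k) u v = zassoc m u v + zassoc k u v" .
qed

text \<open>
  The first two components of an autotopism; they determine the third.
\<close>

definition aut :: "('a::loop \<Rightarrow> 'a) \<Rightarrow> ('a \<Rightarrow> 'a) \<Rightarrow> bool" where
  "aut \<alpha> \<beta> \<longleftrightarrow> (\<exists>\<gamma>. \<forall>a b. \<alpha> a * \<beta> b = \<gamma> (a * b))"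

lemma aut_comp: "aut \<alpha> \<beta> \<Longrightarrow> aut \<alpha>' \<beta>' \<Longrightarrow> aut (\<lambda>a. \<alpha>' (\<alpha> a)) (\<lambda>b. \<beta>' (\<beta> b))"
  unfolding aut_def
proof (elim exE)
  fix \<gamma> \<gamma>'
  assume 1: "\<forall>a b. \<alpha> a * \<beta> b = \<gamma> (a * b)" and 2: "\<forall>a b. \<alpha>' a * \<beta>' b = \<gamma>' (a * b)"
  show "\<exists>\<gamma>. \<forall>a b. \<alpha>' (\<alpha> a) * \<beta>' (\<beta> b) = \<gamma> (a * b)"
    by (rule exI[of _ "\<lambda>c. \<gamma>' (\<gamma> c)"]) (simp add: 1 2)
qed

lemma aut_mult: "aut (\<lambda>a. x * a) (\<lambda>b. b rdiv x)" for x :: "'a::buchsteiner_loop"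
  unfolding aut_def by (rule exI[of _ "\<lambda>c. x * (c rdiv x)"]) (simp add: buch_mult)

lemma aut_ldiv: "aut (\<lambda>a. x ldiv a) (\<lambda>b. b * x)" for x :: "'a::buchsteiner_loop"
  unfolding aut_def by (rule exI[of _ "\<lambda>c. (x ldiv c) * x"]) (simp add: buch_ldiv)

lemma aut_eq: "aut \<alpha> \<beta> \<Longrightarrow> \<alpha> a * \<beta> b = \<alpha> (a * b) * \<beta> 1"
  unfolding aut_def by (metis loop_one_right)

text \<open>
  The first component of the autotopism whose second component is left multiplication by \<open>wx \<cdot> y\<close>
  followed by left division by \<open>w \<cdot> xy\<close>.  It is a word in left translations; the corresponding word in
  right translations collapses to this second component.
\<close>

definition aut_left :: "'a::loop \<Rightarrow> 'a \<Rightarrow> 'a \<Rightarrow> 'a \<Rightarrow> 'a" where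
  "aut_left w x y a = w * outer x y (w ldiv (outer w y ((w * x) * y * (y ldiv ((w * x) ldiv a)))))"

lemma aut_left_autotopism:
  fixes w x y a b :: "'a::buchsteiner_loop"
  defines "v \<equiv> w * (x * y)" and "V \<equiv> (w * x) * y"
  shows "aut_left w x y a * (v ldiv (V * b)) = aut_left w x y (a * b) * (v ldiv V)"
proof -
  let ?\<beta> = "\<lambda>b. ((((((((b * (w * x)) * y) rdiv V) * (w * y)) rdiv y) * (x * y)) rdiv y) rdiv x) rdiv w"
  have "aut (\<lambda>a. w * (x * (y * ((x * y) ldiv (y * ((w * y) ldiv (V * (y ldiv ((w * x) ldiv a)))))))))
     ?\<beta>"
    by (rule aut_comp[OF aut_comp[OF aut_comp[OF aut_comp[OF aut_comp[OF aut_comp[OF aut_comp[OF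
      aut_comp[OF aut_ldiv aut_ldiv] aut_mult] aut_ldiv] aut_mult] aut_ldiv] aut_mult] aut_mult] aut_mult])
  moreover have "(\<lambda>a. w * (x * (y * ((x * y) ldiv (y * ((w * y) ldiv (V * (y ldiv ((w * x) ldiv a))))))))) = aut_left w x y"
    by (rule ext) (simp add: aut_left_def outer_def V_def)
  ultimately have 1: "aut (aut_left w x y) ?\<beta>" by (simp only:)
  have 2: "?\<beta> b = v ldiv (V * b)" for b
  proof -
    define b' where "b' = inner_inv (w * x) y b"
    define s where "s = inner w y b'"
    have b: "b = inner (w * x) y b'" by (simp add: b'_def)
    \<comment> \<open>Conjugation by a right translation maps left translations to quotients of left translations.\<close>
    have conj: "inner x y (s * w) = (v ldiv ((w * x) * (w ldiv ((w * y) * s)))) * w"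
    proof -
      define q where "q = w ldiv ((w * y) * s)"
      define t where "t = v ldiv ((w * x) * q)"
      have "y * (s * w) = q * w" unfolding q_def buchsteiner by simp
      moreover have "x * (q * w) = (w ldiv ((w * x) * q)) * w" unfolding buchsteiner by simp
      moreover have "(x * y) * (t * w) = (w ldiv (v * t)) * w"
        unfolding v_def buchsteiner by simp
      moreover have "v * t = (w * x) * q" by (simp add: t_def)
      ultimately have "(x * y) * inner x y (s * w) = (x * y) * (t * w)" by (simp add: mult_inner)
      thus ?thesis by (simp add: t_def q_def)
    qed
    have "((b * (w * x)) * y) rdiv V = b'"
      unfolding b V_def by (simp add: rdiv_eq_iff inner_right)
    moreover have "(b' * (w * y)) rdiv y = s * w"
      by (simp add: rdiv_eq_iff s_def inner_right)
    moreover have "(((s * w) * (x * y)) rdiv y) rdiv x = inner x y (s * w)"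
      by (simp add: rdiv_eq_iff inner_right[of "s * w"])
    moreover have "inner x y (s * w) rdiv w = v ldiv (V * b)"
      unfolding conj by (simp add: s_def mult_inner b V_def)
    ultimately show ?thesis by simp
  qed
  from aut_eq[OF 1, of a b] show ?thesis unfolding 2 by simp
qed

text \<open>
  With \<open>p\<close> quasi-nuclear, the autotopism is \<open>\<alpha>(a) \<cdot> pb = \<alpha>(ab) p\<close> up to associators containing \<open>p\<close>.  If \<open>p\<close>
  and \<open>t = \<alpha>(1)p\<close> were nuclear this would be associativity; the deviations are matched here.
\<close>

lemma aut_left_shift:
  fixes w x y :: "'a::buchsteiner_loop"
  defines "p \<equiv> associator w x y"
  defines "t \<equiv> aut_left w x y 1 * p"
  assumes p: "quasi_nuclear p"
  shows "zassoc t a b = zassoc a p b"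
proof -
  interpret p: quasi_nuclear p by (rule p)
  define v where "v = w * (x * y)"
  define \<alpha> where "\<alpha> = aut_left w x y"
  define n where "n = (\<lambda>b. zassoc v p b - zassoc (\<alpha> 1) p b)"
  have V: "(w * x) * y = v * p" by (simp add: v_def p_def mult_associator[of w x y])
  have 1: "\<alpha> a * (v ldiv ((v * p) * b)) = \<alpha> (a * b) * p" for a b
    using aut_left_autotopism[of w x y a b] unfolding V \<alpha>_def by (simp flip: v_def)
  have 2: "v ldiv ((v * p) * b) = (p * b) \<odot> zassoc v p b" for b
    by (simp add: ldiv_eq_iff mult_zassoc[OF p.nuclear_assoc2] mult_zmul)
  have 3: "(\<alpha> a * p) * b = (\<alpha> (a * b) * p) \<odot> (zassoc (\<alpha> a) p b - zassoc v p b)" for a b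
  proof -
    have "(\<alpha> a * p) * b = ((\<alpha> a * (p * b)) \<odot> zassoc v p b) \<odot> (zassoc (\<alpha> a) p b - zassoc v p b)"
      by (simp add: mult_zassoc[OF p.nuclear_assoc2])
    moreover have "(\<alpha> a * (p * b)) \<odot> zassoc v p b = \<alpha> (a * b) * p"
      using 1[of a b] unfolding 2 by (simp only: mult_zmul)
    ultimately show ?thesis by (simp only:)
  qed
  have 4: "\<alpha> b * p = (t * b) \<odot> n b" for b
    using 3[of 1 b] by (simp add: t_def n_def \<alpha>_def)
  have n: "n (a * b) = act b (n a) + n b" for a b
    by (simp add: n_def p.zassoc_mid.D_mult algebra_simps)
  have 5: "(t * a) * b = (t * (a * b)) \<odot> (zassoc (\<alpha> a) p b - zassoc (\<alpha> 1) p b)" for a b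
  proof -
    have "((t * a) * b) \<odot> act b (n a) = (\<alpha> a * p) * b" by (simp add: 4 zmul_mult)
    also have "\<dots> = (\<alpha> (a * b) * p) \<odot> (zassoc (\<alpha> a) p b - zassoc v p b)" by (rule 3)
    also have "\<dots> = (t * (a * b)) \<odot> (n (a * b) + (zassoc (\<alpha> a) p b - zassoc v p b))"
      by (simp add: 4)
    finally have "(((t * a) * b) \<odot> act b (n a)) \<odot> (- act b (n a)) =
      ((t * (a * b)) \<odot> (n (a * b) + (zassoc (\<alpha> a) p b - zassoc v p b))) \<odot> (- act b (n a))" by simp
    thus ?thesis by (simp add: n) (simp add: n_def)
  qed
  note 6 = zassoc_eqI[OF 5]
  interpret t: quasi_nuclear t by standard (rule 6(1))
  have tp: "zassoc t p b = 0" for b unfolding p_def by (rule t.T_associator_left)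
  have pp: "zassoc p p b = 0" for b unfolding p_def by (rule p.T_associator_left[unfolded p_def])
  have \<alpha>: "zassoc (\<alpha> a) p b = zassoc a p b" for a b
  proof -
    have "zassoc (\<alpha> a) p b = zassoc (\<alpha> a * p) p b" by (simp add: p.zassoc_mid_mult_left pp) (simp add: p_def)
    also have "\<dots> = zassoc a p b" unfolding 4 by (simp add: p.zassoc_mid_zmul_left p.zassoc_mid_mult_left tp)
    finally show ?thesis .
  qed
  have "zassoc 1 p b = 0" by (rule zassoc_nuc_left) simp
  thus ?thesis unfolding 6(2) \<alpha> by simp
qed

section \<open>Descent from the quotient\<close>

lemma qproj_associator: "qproj (associator x y z) = associator (qproj x) (qproj y) (qproj z)"
  by (simp add: associator_def qproj_mult qproj_ldiv)

lemma associator_nuc_left: "n \<in> nuc \<Longrightarrow> associator n y z = 1" for n :: "'a::loop"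
  by (simp add: associator_def nuc_left)

lemma quasi_nuclear_iff: "quasi_nuclear m \<longleftrightarrow> qproj m \<in> nuc"
proof
  assume "quasi_nuclear m"
  then interpret quasi_nuclear m .
  have "(qproj m * qproj x) * qproj y = qproj m * (qproj x * qproj y)" for x y
  proof -
    have "qproj (associator m x y) = 1" using nuclear_assoc1[of x y] by (simp add: nuclear_assoc_def qproj_nuc)
    thus ?thesis
      using mult_associator[of "qproj m" "qproj x" "qproj y"] by (simp add: qproj_associator)
  qed
  hence "(qproj m * X) * Y = qproj m * (X * Y)" for X Y using qproj_surj by metis
  thus "qproj m \<in> nuc" by (simp add: nuc_def)
next
  assume m: "qproj m \<in> nuc"
  show "quasi_nuclear m"
  proof
    fix x y show "nuclear_assoc m x y"
      unfolding nuclear_assoc_def qproj_eq_1_iff[symmetric] qproj_associator by (rule associator_nuc_left[OF m])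
  qed
qed

lemma zassoc_nuc_mid: "k \<in> nuc \<Longrightarrow> zassoc q k v = 0"
  by (rule zassoc_eqI(2)) (simp add: nuc_mid)

lemma zassoc_cong_qproj:
  assumes "quasi_nuclear q" "qproj q = qproj q'" shows "zassoc q a b = zassoc q' a b"
proof -
  obtain k where k: "k \<in> nuc" "q' = q * k" using assms(2) by (auto simp: qproj_eq_iff nrel_def)
  have "quasi_nuclear k" by standard (rule nuclear_assoc_nuc_left[OF k(1)])
  thus ?thesis
    using zassoc_mult_quasi(2)[OF assms(1), of k a b] k by (simp add: zassoc_nuc_mid zassoc_nuc_left)
qed

text \<open>
  Quasi-nuclear elements that behave as associators do: they act trivially, and
  \<open>[m,q,v] = 0\<close> for quasi-nuclear \<open>m\<close>.  On such elements \<open>[q,a,b]\<close> is additive in \<open>q\<close>, so that relations between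
  associators of the quotient can be transported.
\<close>

definition special :: "'a::buchsteiner_loop \<Rightarrow> bool" where
  "special q \<longleftrightarrow> quasi_nuclear q \<and> (\<forall>n. act q n = n) \<and> (\<forall>m v. quasi_nuclear m \<longrightarrow> zassoc m q v = 0)"

definition special_class :: "'a::buchsteiner_loop nquot znuc \<Rightarrow> bool" where
  "special_class n \<longleftrightarrow> (\<exists>q. qproj q = Rep_znuc n \<and> special q)"

text \<open>
  The associator \<open>[q,a,b]\<close> depends only on the class of \<open>q\<close> modulo the nucleus (\<open>lift_assoc_eq\<close>).
\<close>

definition lift_assoc :: "'a::buchsteiner_loop nquot znuc \<Rightarrow> 'a \<Rightarrow> 'a \<Rightarrow> 'a znuc" where
  "lift_assoc n a b = zassoc (SOME q. qproj q = Rep_znuc n) a b"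

lemma quasi_rep: "qproj q = Rep_znuc n \<Longrightarrow> quasi_nuclear q"
  by (simp add: quasi_nuclear_iff)

lemma lift_assoc_eq: assumes "qproj q = Rep_znuc n" shows "lift_assoc n a b = zassoc q a b"
proof -
  have *: "qproj (SOME q. qproj q = Rep_znuc n) = Rep_znuc n"
    using assms by (rule someI)
  show ?thesis unfolding lift_assoc_def
    by (rule zassoc_cong_qproj[OF quasi_rep[OF *]]) (simp add: assms *)
qed

lemma special_mult: assumes "special q" "special r" shows "special (q * r)"
  unfolding special_def
proof (intro conjI allI impI)
  show "quasi_nuclear (q * r)"
    using assms by (simp add: special_def quasi_nuclear_iff qproj_mult)
  show "act (q * r) n = n" for n using assms by (simp add: special_def act_mult)
  fix m :: 'a and v assume "quasi_nuclear m"
  thus "zassoc m (q * r) v = 0"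
    using assms by (simp add: special_def quasi_nuclear.T_mult_left)
qed

lemma special_rho: assumes "special q" shows "special (rho q)"
  unfolding special_def
proof (intro conjI allI impI)
  show "quasi_nuclear (rho q)"
    using assms inv_nuc(1)[of "qproj q"] by (simp add: special_def quasi_nuclear_iff qproj_ldiv)
  show "act (rho q) n = n" for n
  proof -
    have "act q n = n" using assms by (simp add: special_def)
    thus ?thesis using act_rho[of q n] by simp
  qed
  fix m :: 'a and v assume m: "quasi_nuclear m"
  have "zassoc m (q * rho q) v = act (rho q) (zassoc m q v) + zassoc m (rho q) v"
    by (rule quasi_nuclear.T_mult_left[OF m])
  moreover have "zassoc m 1 v = 0" by (rule zassoc_nuc_mid) simp
  ultimately show "zassoc m (rho q) v = 0" using assms m by (simp add: special_def)
qed

lemma special_conj: assumes "special q" shows "special (x ldiv (q * x))"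
  unfolding special_def
proof (intro conjI allI impI)
  let ?r = "x ldiv (q * x)"
  show "quasi_nuclear ?r"
    using assms by (simp add: special_def quasi_nuclear_iff qproj_ldiv qproj_mult conj_nuc)
  show act: "act ?r n = n" for n
  proof -
    obtain k where n: "n = act x k" by (metis act_lam)
    have "act ?r n = act (x * ?r) k" by (simp only: n act_mult)
    also have "\<dots> = act (q * x) k" by simp
    finally show ?thesis using assms by (simp add: n act_mult special_def)
  qed
  fix m :: 'a and v assume m: "quasi_nuclear m"
  have "zassoc m (x * ?r) v = act ?r (zassoc m x v) + zassoc m ?r v"
    by (rule quasi_nuclear.T_mult_left[OF m])
  moreover have "zassoc m (q * x) v = act x (zassoc m q v) + zassoc m x v"
    by (rule quasi_nuclear.T_mult_left[OF m])
  ultimately show "zassoc m ?r v = 0" using assms m by (simp add: act special_def)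
qed

lemma special_class_add: assumes "special_class n" "special_class k" shows "special_class (n + k)"
proof -
  obtain q r where "qproj q = Rep_znuc n" "special q" "qproj r = Rep_znuc k" "special r"
    using assms unfolding special_class_def by blast
  thus ?thesis unfolding special_class_def
    by (intro exI[of _ "q * r"]) (simp add: special_mult qproj_mult plus_znuc.rep_eq)
qed

lemma special_class_minus: assumes "special_class n" shows "special_class (- n)"
proof -
  obtain q where "qproj q = Rep_znuc n" "special q" using assms unfolding special_class_def by blast
  thus ?thesis unfolding special_class_def
    by (intro exI[of _ "rho q"]) (simp add: special_rho qproj_ldiv uminus_znuc.rep_eq)
qed

lemma special_class_diff: "special_class n \<Longrightarrow> special_class k \<Longrightarrow> special_class (n - k)"
  unfolding minus_znuc_def by (intro special_class_add special_class_minus)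

lemma special_class_act: assumes "special_class n" shows "special_class (act X n)"
proof -
  obtain q where q: "qproj q = Rep_znuc n" "special q" using assms unfolding special_class_def by blast
  obtain x where x: "X = qproj x" using qproj_surj by blast
  show ?thesis unfolding special_class_def
    by (rule exI[of _ "x ldiv (q * x)"]) (simp add: q special_conj qproj_ldiv qproj_mult act.rep_eq x)
qed

lemma lift_assoc_add: assumes "special_class n" "special_class k" shows "lift_assoc (n + k) a b = lift_assoc n a b + lift_assoc k a b"
proof -
  obtain q r where q: "qproj q = Rep_znuc n" and r: "qproj r = Rep_znuc k" "special r"
    using assms unfolding special_class_def by blast
  have "lift_assoc (n + k) a b = zassoc (q * r) a b"
    by (rule lift_assoc_eq) (simp add: q r qproj_mult plus_znuc.rep_eq)
  also have "\<dots> = zassoc q a b + zassoc r a b"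
    using r(2) quasi_rep[OF q] by (intro zassoc_mult_quasi(2)) (simp_all add: special_def)
  finally show ?thesis by (simp add: lift_assoc_eq[OF q] lift_assoc_eq[OF r(1)])
qed

lemma special_class_0: "special_class 0"
  unfolding special_class_def special_def
  by (rule exI[of _ 1]) (simp add: zero_znuc.rep_eq zassoc_nuc_mid quasi_nuclear_iff)

lemma lift_assoc_0: "lift_assoc 0 a b = 0" using lift_assoc_add[OF special_class_0 special_class_0, of a b] by simp

lemma lift_assoc_minus: assumes "special_class n" shows "lift_assoc (- n) a b = - lift_assoc n a b"
  using lift_assoc_add[OF special_class_minus[OF assms] assms, of a b] by (simp add: lift_assoc_0 eq_neg_iff_add_eq_0)

lemma lift_assoc_diff: "special_class n \<Longrightarrow> special_class k \<Longrightarrow> lift_assoc (n - k) a b = lift_assoc n a b - lift_assoc k a b"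
  using lift_assoc_add[of n "- k" a b] by (simp add: special_class_minus lift_assoc_minus)

lemma special_associator:
  assumes "quasi_nuclear (associator x y z)" shows "special (associator x y z)"
  unfolding special_def using assms by (auto simp: quasi_nuclear.T_associator_left)

text \<open>
  In the quotient the companion commutes with everything, so the associator that represents it is
  fixed by the action.
\<close>

lemma left_companion_nquot:
  fixes X Y :: "'a::buchsteiner_loop nquot"
  assumes "\<And>Z. nuclear_assoc X Y Z"
  shows "left_companion X Y = 1 \<odot> zassoc X Y (X * Y)" and "act g (zassoc X Y (X * Y)) = zassoc X Y (X * Y)"
proof -
  interpret D: derivation "zassoc X Y" by standard (rule zassoc_derivation[OF assms])
  let ?r = "rho (X * Y)" and ?d = "zassoc X Y (X * Y)"
  have "X * (Y * ?r) = ((X * (Y * ?r)) \<odot> zassoc X Y ?r) \<odot> (- zassoc X Y ?r)" by simp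
  also have "\<dots> = ((X * Y) * ?r) \<odot> (- zassoc X Y ?r)" by (simp only: mult_zassoc[OF assms])
  finally have "X * (Y * ?r) = ((X * Y) * ?r) \<odot> (- zassoc X Y ?r)" .
  moreover have "- zassoc X Y ?r = act ?r ?d"
    using D.D_mult[of "X * Y" ?r] by (simp add: D.D_one neg_eq_iff_add_eq_0 add.commute)
  ultimately have l: "left_companion X Y = 1 \<odot> act ?r ?d" by (simp add: left_companion_def outer_def)
  have inv: "act g (act ?r ?d) = act ?r ?d" for g
    using left_companion_nquot_commute[of X Y g] unfolding l by (simp add: zmul_mult mult_zmul)
  from inv[of "X * Y"] have d: "act ?r ?d = ?d" by (simp add: act_rho')
  show "left_companion X Y = 1 \<odot> ?d" using l d by simp
  show "act g ?d = ?d" using inv[of g] d by simp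
qed

locale quotient_nuclear =
  fixes ty :: "'a::buchsteiner_loop itself"
  assumes nuclear_assoc_quotient: "\<And>X Y Z :: 'a nquot. nuclear_assoc X Y Z"
begin

sublocale Q: assoc_nuclear "TYPE('a nquot)" by standard (rule nuclear_assoc_quotient)

definition companion_class :: "'a nquot \<Rightarrow> 'a nquot \<Rightarrow> 'a nquot znuc" where "companion_class X Y = zassoc X Y (X * Y)"

definition shift_class :: "'a nquot \<Rightarrow> 'a nquot \<Rightarrow> 'a nquot \<Rightarrow> 'a nquot znuc" where
  "shift_class W X Y = companion_class X Y + companion_class W Y - companion_class (W * X) Y"

lemma left_companion_class: "left_companion X Y = 1 \<odot> companion_class X Y" for X Y :: "'a nquot"
  unfolding companion_class_def by (rule left_companion_nquot(1)[OF nuclear_assoc_quotient])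

lemma act_companion_class: "act g (companion_class X Y) = companion_class X Y" for X Y :: "'a nquot"
  unfolding companion_class_def by (rule left_companion_nquot(2)[OF nuclear_assoc_quotient])

lemma outer_nquot: "outer X Y (U \<odot> n) = U \<odot> (companion_class X Y - zassoc X Y U + n)" for X Y U :: "'a nquot"
proof -
  have "outer X Y (U \<odot> n) = outer X Y U \<odot> n"
  proof -
    have "(X * Y) ldiv (U \<odot> n) = ((X * Y) ldiv U) \<odot> n" by (simp add: ldiv_eq_iff mult_zmul)
    thus ?thesis by (simp add: outer_def mult_zmul)
  qed
  thus ?thesis
    by (simp add: outer_eq left_companion_class zmul_mult mult_zmul inner_zassoc[OF nuclear_assoc_quotient] act_companion_class add.commute)
qed

text \<open>
  In the quotient the value \<open>\<alpha>(1)\<close> can be computed.  It contributes the inverse of the associator, and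
  only the companions remain.
\<close>

lemma aut_left_one: "aut_left W X Y 1 * associator W X Y = 1 \<odot> shift_class W X Y" for W X Y :: "'a nquot"
proof -
  let ?V = "(W * X) * Y"
  have A1: "zassoc X Y 1 = 0" for X Y :: "'a nquot" by (rule Q.T.D_one)
  have "outer (W * X) Y (?V * (Y ldiv ((W * X) ldiv 1))) = 1" by (simp add: outer_def)
  moreover have "outer (W * X) Y (1 \<odot> (- companion_class (W * X) Y)) = 1" unfolding outer_nquot by (simp add: A1)
  ultimately have "outer (W * X) Y (?V * (Y ldiv ((W * X) ldiv 1))) = outer (W * X) Y (1 \<odot> (- companion_class (W * X) Y))"
    by (simp only:)
  hence 1: "?V * (Y ldiv ((W * X) ldiv 1)) = 1 \<odot> (- companion_class (W * X) Y)"
    by (simp only: outer_def mult_left_cancel ldiv_left_cancel)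
  have "outer W Y (1 \<odot> (- companion_class (W * X) Y)) = 1 \<odot> (companion_class W Y - companion_class (W * X) Y)"
    unfolding outer_nquot by (simp add: A1)
  moreover have "W ldiv (1 \<odot> n) = rho W \<odot> n" for n by (simp add: ldiv_eq_iff mult_zmul)
  ultimately have "aut_left W X Y 1 = 1 \<odot> (companion_class X Y - zassoc X Y (rho W) + (companion_class W Y - companion_class (W * X) Y))"
    unfolding aut_left_def 1 by (simp add: outer_nquot mult_zmul)
  moreover have "zassoc X Y (rho W) = zassoc W X Y"
  proof -
    have "zassoc X Y (W * rho W) = act (rho W) (zassoc X Y W) + zassoc X Y (rho W)" by (rule Q.zassoc_mult3)
    hence "- zassoc X Y (rho W) = act (rho W) (zassoc X Y W)" by (simp add: A1 neg_eq_iff_add_eq_0 add.commute)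
    moreover have "act W (zassoc W X Y) = - zassoc X Y W"
      unfolding Q.zassoc_cyc2[of W X Y] by (rule zassoc_cycle3[OF nuclear_assoc_quotient])
    hence "zassoc X Y W = - act W (zassoc W X Y)" by simp
    hence "act (rho W) (zassoc X Y W) = - zassoc W X Y" by (simp only: act_minus act_rho)
    ultimately show ?thesis by simp
  qed
  moreover have "associator W X Y = 1 \<odot> zassoc W X Y" by (simp add: zmul_def Rep_zassoc[OF nuclear_assoc_quotient])
  ultimately show ?thesis by (simp add: mult_zmul shift_class_def)
qed

lemma quasi_associator: "quasi_nuclear (associator w x y)" for w x y :: 'a
  unfolding quasi_nuclear_iff qproj_associator using nuclear_assoc_quotient by (simp add: nuclear_assoc_def)

lemma special_class_zassoc: "special_class (zassoc X Y Z)" for X Y Z :: "'a nquot"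
proof -
  obtain x y z where "X = qproj x" "Y = qproj y" "Z = qproj z" using qproj_surj by metis
  thus ?thesis unfolding special_class_def
    by (intro exI[of _ "associator x y z"])
      (simp add: special_associator quasi_associator qproj_associator Rep_zassoc[OF nuclear_assoc_quotient])
qed

lemma zassoc_associator: "zassoc a (associator w x y) b = lift_assoc (shift_class (qproj w) (qproj x) (qproj y)) a b" for w x y :: 'a
proof -
  let ?t = "aut_left w x y 1 * associator w x y"
  have "qproj ?t = aut_left (qproj w) (qproj x) (qproj y) 1 * associator (qproj w) (qproj x) (qproj y)"
    by (simp add: qproj_mult qproj_associator aut_left_def outer_def qproj_ldiv)
  also have "\<dots> = Rep_znuc (shift_class (qproj w) (qproj x) (qproj y))"
    by (simp add: aut_left_one) (simp add: zmul_def)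
  finally have "lift_assoc (shift_class (qproj w) (qproj x) (qproj y)) a b = zassoc ?t a b" by (rule lift_assoc_eq)
  thus ?thesis by (simp add: aut_left_shift[OF quasi_associator])
qed

lemma act_lift_assoc: "act b (lift_assoc (zassoc W X Y) b a) = lift_assoc (shift_class W X Y) a b" for W X Y :: "'a nquot"
proof -
  obtain w x y where wxy: "W = qproj w" "X = qproj x" "Y = qproj y" using qproj_surj by metis
  have "lift_assoc (zassoc W X Y) b a = zassoc (associator w x y) b a"
    by (rule lift_assoc_eq) (simp add: wxy qproj_associator Rep_zassoc[OF nuclear_assoc_quotient])
  moreover have "zassoc a (associator w x y) b = act b (zassoc (associator w x y) b a)"
    using quasi_nuclear.zassoc_mid[OF quasi_associator, of a w x y b] by simp
  ultimately show ?thesis using zassoc_associator[of a w x y b] by (simp add: wxy)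
qed

lemma shift_class_swap: "shift_class W X Y = shift_class X W Y" for W X Y :: "'a nquot"
proof -
  have 1: "zassoc (W * X) Y Z = zassoc (X * W) Y Z" for Z
    using Q.shift_swap01[of X W Y Z] by (simp add: Q.zassoc_mult1 Q.act_zassoc algebra_simps)
  have "zassoc U Y (W * X) = zassoc U Y (X * W)" for U by (rule Q.T.D_commute)
  hence "companion_class (W * X) Y = companion_class (X * W) Y" unfolding companion_class_def 1 by (simp add: Q.zassoc_mult3[of _ _ _ Y])
  thus ?thesis by (simp add: shift_class_def algebra_simps)
qed

text \<open>
  The element \<open>shift_class W X Y\<close> is symmetric in \<open>W\<close> and \<open>X\<close>, hence so is the associator it determines.
\<close>

lemma lift_assoc_swap: "lift_assoc (zassoc W X Y) a b = lift_assoc (zassoc X W Y) a b" for W X Y :: "'a nquot"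
proof -
  have "act b (lift_assoc (zassoc W X Y) b a) = act b (lift_assoc (zassoc X W Y) b a)" for a b
    by (simp only: act_lift_assoc shift_class_swap[of W X Y])
  thus ?thesis by (simp only: act_inj)
qed

text \<open>
  Apply the additive map \<open>g = lift_assoc _ a b\<close> to the relations between the six associators of \<open>X\<close>, \<open>Y\<close>, \<open>Z\<close>.
  Invariance under transposition of the first two arguments makes \<open>g\<close> vanish at \<open>r\<close> and forces the
  values at \<open>s1\<close>, \<open>s2\<close> and \<open>s3\<close> to be \<open>-2 g(P)\<close>.  In \<open>shift_class Z X Y\<close> everything then cancels.
\<close>

lemma lift_assoc_shift_class: "lift_assoc (shift_class Z X Y) a b = 0" for X Y Z :: "'a nquot"
proof -
  define g where "g = (\<lambda>n. lift_assoc n a b)"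
  note special_class = special_class_add special_class_minus special_class_diff special_class_act special_class_zassoc
  have add: "g (n + k) = g n + g k" if "special_class n" "special_class k" for n k using that by (simp add: g_def lift_assoc_add)
  have diff: "g (n - k) = g n - g k" if "special_class n" "special_class k" for n k using that by (simp add: g_def lift_assoc_diff)
  have minus: "g (- n) = - g n" if "special_class n" for n using that by (simp add: g_def lift_assoc_minus)
  have swap: "g (zassoc U V W) = g (zassoc V U W)" for U V W by (simp add: g_def lift_assoc_swap)
  define P where "P = zassoc X Y Z"
  define r where "r = P - zassoc Z Y X"
  define s1 where "s1 = shift_assoc X X Y Z"
  define s2 where "s2 = shift_assoc Y X Y Z"
  define s3 where "s3 = shift_assoc Z X Y Z"
  have sps [simp]: "special_class P" "special_class r" "special_class s1" "special_class s2" "special_class s3"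
    by (simp_all add: P_def r_def s1_def s2_def s3_def shift_assoc_def special_class)
  have Q: "zassoc Z Y X = P - r" by (simp add: r_def)
  have Sx: "shift_assoc W Z Y X = shift_assoc W X Y Z" for W by (metis Q.shift_swap12 Q.shift_swap23)
  have actP: "act X P = P + s1" "act Y P = P + s2" "act Z P = P + s3"
    unfolding P_def s1_def s2_def s3_def by (rule Q.act_zassoc)+
  have actQ: "act Z (P - r) = P - r + s3"
    unfolding Q[symmetric] s3_def Sx[of Z, symmetric] by (rule Q.act_zassoc)
  have neg: "act Y s1 = - s1" "act Y s3 = - s3"
    by (simp_all add: s1_def s3_def Q.shift_neg2)
  have rinv: "act X r = r" "act Y r = r"
    using Q.associator_relations(4,5)[where x = X and y = Y and z = Z] by (simp_all add: r_def P_def)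
  have A1: "zassoc Y Z X = - P - s1" unfolding Q.zassoc_cyc[of Y Z X] P_def[symmetric] actP by simp
  have A2: "zassoc Z X Y = P + s2 - s1"
    unfolding Q.zassoc_cyc2[of Z X Y] P_def[symmetric] actP by (simp add: actP neg)
  have A3: "zassoc Y X Z = - P + r - s3" unfolding Q.zassoc_cyc[of Y X Z] Q actQ by simp
  have A4: "zassoc X Z Y = P - r + s2 - s3"
    unfolding Q.zassoc_cyc2[of X Z Y] Q actQ by (simp add: actP neg rinv)
  have "- (P + P) = s1 - s2 + s3"
    unfolding P_def s1_def s2_def s3_def by (rule Q.zassoc_double)
  hence "g (- (P + P)) = g (s1 - s2 + s3)" by (simp only:)
  hence e0: "- (g P + g P) = g s1 - g s2 + g s3"
    by (simp add: add diff minus special_class del: minus_add_distrib)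
  have e1: "- g P - g s1 = g P - g r"
    using swap[of Y Z X] unfolding A1 Q by (simp add: diff minus special_class)
  have e2: "g P = - g P + g r - g s3"
    using swap[of X Y Z] unfolding A3 P_def[symmetric] by (simp add: diff add minus special_class)
  have e3: "g P + g s2 - g s1 = g P - g r + g s2 - g s3"
    using swap[of Z X Y] unfolding A2 A4 by (simp add: diff add minus special_class)
  have s1: "g s1 = g r - g P - g P" using e1 by (simp add: algebra_simps)
  have s3: "g s3 = g r - g P - g P" using e2 by (simp add: algebra_simps)
  have r0: "g r = 0" using e3 unfolding s1 s3 by (simp add: algebra_simps)
  have s2: "g s2 = - g P - g P" using e0 unfolding s1 s3 r0 by (simp add: algebra_simps)
  have "shift_class Z X Y = - (P + P) - (s2 + s2) + (s1 + s1) + r - s2"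
  proof -
    have B1: "companion_class X Y = act Y (zassoc X Y X) + zassoc X Y Y" by (simp add: companion_class_def Q.zassoc_mult3)
    have B2: "companion_class Z Y = act Y (zassoc Z Y Z) + zassoc Z Y Y" by (simp add: companion_class_def Q.zassoc_mult3)
    have "zassoc (Z * X) Y (Z * X) = zassoc Z Y Z + act X (zassoc X Y Z + zassoc Z Y X) + zassoc X Y X"
      by (simp add: Q.zassoc_mult3 Q.zassoc_mult1 algebra_simps)
    hence B3: "companion_class (Z * X) Y = act Y (zassoc Z Y Z) + act Y (act X (zassoc X Y Z + zassoc Z Y X)) + act Y (zassoc X Y X)
        + act X (zassoc Z Y Y) + zassoc X Y Y"
      unfolding companion_class_def by (simp add: Q.zassoc_mult3[of _ _ _ Y] Q.zassoc_mult1[of _ _ _ Y] algebra_simps)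
    have "shift_assoc X Z Y Y = s2" unfolding s2_def by (metis Q.shift_swap01 Q.shift_swap12 Q.shift_swap23)
    hence B4: "act X (zassoc Z Y Y) = zassoc Z Y Y + s2" by (simp add: Q.act_zassoc)
    have B5: "act Y (act X (zassoc X Y Z + zassoc Z Y X)) = P + s2 - s1 + (P + s2 - s1) - r"
      unfolding Q P_def[symmetric] by (simp add: actP neg rinv)
    show ?thesis unfolding shift_class_def B1 B2 B3 B4 B5 by (simp add: algebra_simps)
  qed
  hence "g (shift_class Z X Y) = - (g P + g P) - (g s2 + g s2) + (g s1 + g s1) + g r - g s2"
    by (simp add: add diff minus special_class)
  also have "\<dots> = 0" unfolding s1 s2 r0 by simp
  finally show ?thesis by (simp add: g_def)
qed

text \<open>
  By \<open>zassoc_associator\<close> and \<open>lift_assoc_shift_class\<close>, every associator is middle nuclear.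
\<close>

lemma associator_nuc: "nuclear_assoc w x y" for w x y :: 'a
proof -
  interpret p: quasi_nuclear "associator w x y" by (rule quasi_associator)
  have "associator w x y \<in> nuc"
    by (rule nuc_if_zassoc_mid[OF p.nuclear_assoc2]) (simp add: zassoc_associator lift_assoc_shift_class)
  thus ?thesis by (simp add: nuclear_assoc_def)
qed

end

section \<open>All associators are nuclear\<close>

lemma inner_self_nquot:
  assumes "\<And>x y :: 'a::buchsteiner_loop. inner x y (x * y) = x * y"
  shows "inner X Y (X * Y) = X * (Y :: 'a nquot)"
proof -
  obtain x y where "X = qproj x" "Y = qproj y" using qproj_surj by metis
  thus ?thesis using assms[of x y] by (metis qproj_inner qproj_mult)
qed

lemma (in wip) nuclear_assoc_wip: "nuclear_assoc x y (z :: 'a)"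
proof -
  have wq: "wip TYPE('a nquot)" by standard (rule inner_self_nquot[OF inner_self])
  have "(X * Y) * Z = X * (Y * Z)" for X Y Z :: "'a nquot"
  proof (rule wip.group_if_twist_trivial[OF wq])
    fix B X' :: "'a nquot"
    obtain b x where bx: "B = qproj b" "X' = qproj x" using qproj_surj by metis
    obtain n where n: "n \<in> nuc"
      "((b * rho (rho (rho (rho x)))) rdiv rho (rho x)) * (rho (rho x) * x) = b * n"
      using twist_nuc[of x] by blast
    have "qproj (((b * rho (rho (rho (rho x)))) rdiv rho (rho x)) * (rho (rho x) * x)) = qproj b"
      unfolding n(2) by (simp add: qproj_mult qproj_nuc[OF n(1)])
    thus "((B * rho (rho (rho (rho X')))) rdiv rho (rho X')) * (rho (rho X') * X') = B"
      by (simp add: bx qproj_mult qproj_ldiv qproj_rdiv)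
  qed
  hence "associator X Y Z = 1" for X Y Z :: "'a nquot" by (simp add: associator_def)
  thus ?thesis by (simp add: nuclear_assoc_def qproj_associator flip: qproj_eq_1_iff)
qed

text \<open>
  The weak inverse property holds in the second quotient; two descents lead back to the loop itself.
\<close>

theorem associators_nuclear: "nuclear_assoc x y z" for x y z :: "'a::buchsteiner_loop"
proof -
  have 2: "nuclear_assoc X Y Z" for X Y Z :: "'a nquot nquot"
  proof -
    have "wip TYPE('a nquot nquot)" by standard (rule inner_mult_self)
    thus ?thesis by (rule wip.nuclear_assoc_wip)
  qed
  have 1: "nuclear_assoc X Y Z" for X Y Z :: "'a nquot"
  proof -
    interpret quotient_nuclear "TYPE('a nquot)" by standard (rule 2)
    show ?thesis by (rule associator_nuc)
  qed
  interpret quotient_nuclear "TYPE('a)" by standard (rule 1)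
  show ?thesis by (rule associator_nuc)
qed

theorem proposition1p6:
  fixes x y z :: "'a::buchsteiner_loop"
  shows "associator x y z * loop_inv (associator z y x)
           = associator y z x * loop_inv (associator x z y)
       \<and> associator y z x * loop_inv (associator x z y)
           = associator z x y * loop_inv (associator y x z)
       \<and> (let a = associator x y z * loop_inv (associator z y x);
              s\<^sub>x = associator (x\<^sup>2) y z;
              s\<^sub>y = associator (y\<^sup>2) z x;
              s\<^sub>z = associator (z\<^sup>2) y x
          in a\<^sup>2 = 1
           \<and> conjugate a x = a \<and> conjugate a y = a \<and> conjugate a z = a
           \<and> (associator x y z)\<^sup>2 = (associator x z y)\<^sup>2
           \<and> associator (x\<^sup>2) y z = associator (x\<^sup>2) z y
           \<and> associator x y z * loop_inv (associator x z y) = a * s\<^sub>x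
           \<and> a * s\<^sub>x = associator y z x * loop_inv (associator z y x)
           \<and> associator y z x * loop_inv (associator y x z) = a * s\<^sub>y
           \<and> a * s\<^sub>y = associator z x y * loop_inv (associator x z y)
           \<and> associator z x y * loop_inv (associator z y x) = a * s\<^sub>z
           \<and> a * s\<^sub>z = associator x y z * loop_inv (associator y x z))"
proof -
  interpret assoc_nuclear "TYPE('a)" by standard (rule associators_nuclear)
  show ?thesis by (rule associator_identities)
qed

end
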